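(* In the two-dimensional market $\mathcal{M}=\mathbb{R}^2$ with $q=0$, i.e. with aggregate prices $P_i\{\mathbf{x}\}=P_i+\|\mathbf{x}-\mathbf{x}_i\|_2^2-\beta$, $\beta\ge0$, when the market is at a (pure strategy) Nash equilibrium, one has $$P_i=\frac{1}{\sum_{j\in\mathcal{NR}(i)}\frac{l_{ij}}{2d_{ij}}}\,S_i\qquad\text{for all } i\in\mathcal{N},$$ where $\mathcal{NR}(i)$ is the set of neighbors of $i$, $l_{ij}$ is the length of the border line between $i$ and $j$, $d_{ij}=\|\mathbf{x}_i-\mathbf{x}_j\|_2$, and $S_i$ is the market area of $i$, all taken at the equilibrium.
   Context: Market: $\mathcal{M}=\mathbb{R}^2$; each point $\mathbf{x}$ is a customer (uniform, unit density). $\mathcal{N}'$ is the (infinite) set of companies; company $k$ has fixed position $\mathbf{x}_k\in\mathbb{R}^2$. Positions are distinct, every bounded region contains finitely many companies, and there is $r<\infty$ such that every disc of radius $r$ contains at least one company. For a chosen $B>0$, $\mathcal{N}=\{k\in\mathcal{N}' : \|\mathbf{x}_k\|_\infty\le B/2\}$, assumed nonempty (hence finite and nonempty). Only companies in $\mathcal{N}$ are players; every company $j\in\mathcal{N}'\setminus\mathcal{N}$ has a constant price $P_j\equiv P_{j0}\in[0,P_{upper}]$. Each player $i\in\mathcal{N}$ chooses a price $P_i\in[0,P_{upper}]$, where $P_{upper}$ is finite and sufficiently large (larger than some threshold depending on the market data). Aggregate price of company $i$ at customer $\mathbf{x}$: $P_i\{\mathbf{x}\}=P_i+\|\mathbf{x}-\mathbf{x}_i\|_2^2-\beta$.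 Owners of $\mathbf{x}$: $\mathcal{O}'(\mathbf{x},\mathbf{P})=\operatorname{argmin}_{k\in\mathcal{N}'}P_k\{\mathbf{x}\}$. Market area: $\mathcal{S}_i=\{\mathbf{x}:\mathcal{O}'(\mathbf{x},\mathbf{P})=\{i\}\}$, $S_i=|\mathcal{S}_i|$ (planar area); $i$ is surviving if $S_i>0$. Surviving owners of $\mathbf{x}$: $\mathcal{O}(\mathbf{x},\mathbf{P})=\operatorname{argmin}_{k:\,S_k>0}P_k\{\mathbf{x}\}$. Boundary: $\mathcal{BR}(i)=\mathbf{cl}(\mathcal{S}_i)\setminus\mathbf{int}(\mathcal{S}_i)$. Neighbors: $\mathcal{NR}(i)=\{j\ne i : \exists\,\mathbf{x}\in\mathcal{BR}(i)\text{ with } j\in\mathcal{O}(\mathbf{x},\mathbf{P})\}$. The border line between $i$ and $j$ is $\mathbf{cl}(\mathcal{S}_i)\cap\mathbf{cl}(\mathcal{S}_j)$, a segment or a point; $l_{ij}$ is its length. Payoff of $i$: $W_i(\mathbf{P})=P_i\cdot S_i$. A price vector $\mathbf{P}^*$ is a Nash equilibrium if for each $i\in\mathcal{N}$, $P_i^*$ maximizes $P_i\mapsto W_i(P_i,P_{-i}^* )$ over $[0,P_{upper}]$.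
   Formalization: The formula is proved for each player i such that no company of zero market area ties as an owner along a whole segment of the boundary of i; without this condition the claim fails, since the area of i can have a kink in its price at equilibrium. *)

theory Defs
  imports "HOL-Analysis.Analysis"
begin

text \<open>
  Companies are the elements of a set \<open>K\<close> (all companies, players or not), \<open>loc k\<close> is
  the position of company \<open>k\<close>, and \<open>P\<close> is a price vector on \<open>K\<close>.
\<close>

definition players :: "'k set \<Rightarrow> ('k \<Rightarrow> real^2) \<Rightarrow> real \<Rightarrow> 'k set" where
  "players K loc B = {k \<in> K. infnorm (loc k) \<le> B / 2}"

definition agg_price :: "('k \<Rightarrow> real^2) \<Rightarrow> real \<Rightarrow> ('k \<Rightarrow> real) \<Rightarrow> 'k \<Rightarrow> real^2 \<Rightarrow> real" where
  "agg_price loc \<beta> P k x = P k + (norm (x - loc k))\<^sup>2 - \<beta>"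

definition owners ::
  "'k set \<Rightarrow> ('k \<Rightarrow> real^2) \<Rightarrow> real \<Rightarrow> ('k \<Rightarrow> real) \<Rightarrow> real^2 \<Rightarrow> 'k set" where
  "owners K loc \<beta> P x = {k. is_arg_min (\<lambda>k. agg_price loc \<beta> P k x) (\<lambda>k. k \<in> K) k}"

definition market_region ::
  "'k set \<Rightarrow> ('k \<Rightarrow> real^2) \<Rightarrow> real \<Rightarrow> ('k \<Rightarrow> real) \<Rightarrow> 'k \<Rightarrow> (real^2) set" where
  "market_region K loc \<beta> P i = {x. owners K loc \<beta> P x = {i}}"

definition market_area ::
  "'k set \<Rightarrow> ('k \<Rightarrow> real^2) \<Rightarrow> real \<Rightarrow> ('k \<Rightarrow> real) \<Rightarrow> 'k \<Rightarrow> real" where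
  "market_area K loc \<beta> P i = measure lebesgue (market_region K loc \<beta> P i)"

definition surviving ::
  "'k set \<Rightarrow> ('k \<Rightarrow> real^2) \<Rightarrow> real \<Rightarrow> ('k \<Rightarrow> real) \<Rightarrow> 'k set" where
  "surviving K loc \<beta> P = {k \<in> K. market_area K loc \<beta> P k > 0}"

definition surviving_owners ::
  "'k set \<Rightarrow> ('k \<Rightarrow> real^2) \<Rightarrow> real \<Rightarrow> ('k \<Rightarrow> real) \<Rightarrow> real^2 \<Rightarrow> 'k set" where
  "surviving_owners K loc \<beta> P x =
     {k. is_arg_min (\<lambda>k. agg_price loc \<beta> P k x) (\<lambda>k. k \<in> surviving K loc \<beta> P) k}"

definition boundary ::
  "'k set \<Rightarrow> ('k \<Rightarrow> real^2) \<Rightarrow> real \<Rightarrow> ('k \<Rightarrow> real) \<Rightarrow> 'k \<Rightarrow> (real^2) set" where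
  "boundary K loc \<beta> P i =
     closure (market_region K loc \<beta> P i) - interior (market_region K loc \<beta> P i)"

definition neighbors ::
  "'k set \<Rightarrow> ('k \<Rightarrow> real^2) \<Rightarrow> real \<Rightarrow> ('k \<Rightarrow> real) \<Rightarrow> 'k \<Rightarrow> 'k set" where
  "neighbors K loc \<beta> P i =
     {j. j \<noteq> i \<and> (\<exists>x \<in> boundary K loc \<beta> P i. j \<in> surviving_owners K loc \<beta> P x)}"

definition border_line ::
  "'k set \<Rightarrow> ('k \<Rightarrow> real^2) \<Rightarrow> real \<Rightarrow> ('k \<Rightarrow> real) \<Rightarrow> 'k \<Rightarrow> 'k \<Rightarrow> (real^2) set" where
  "border_line K loc \<beta> P i j =
     closure (market_region K loc \<beta> P i) \<inter> closure (market_region K loc \<beta> P j)"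

text \<open>Only meaningful for sets of the form \<open>closed_segment a b\<close>; a point is the case \<open>a = b\<close>.\<close>

definition segment_length :: "'a::euclidean_space set \<Rightarrow> real" where
  "segment_length L = (THE l. \<exists>a b. L = closed_segment a b \<and> l = dist a b)"

definition border_length ::
  "'k set \<Rightarrow> ('k \<Rightarrow> real^2) \<Rightarrow> real \<Rightarrow> ('k \<Rightarrow> real) \<Rightarrow> 'k \<Rightarrow> 'k \<Rightarrow> real" where
  "border_length K loc \<beta> P i j = segment_length (border_line K loc \<beta> P i j)"

definition payoff ::
  "'k set \<Rightarrow> ('k \<Rightarrow> real^2) \<Rightarrow> real \<Rightarrow> ('k \<Rightarrow> real) \<Rightarrow> 'k \<Rightarrow> real" where
  "payoff K loc \<beta> P i = P i * market_area K loc \<beta> P i"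

text \<open>\<open>P0\<close> holds the constant prices of the companies that are not players; its values at
  players are irrelevant.\<close>

definition nash_equilibrium ::
  "'k set \<Rightarrow> ('k \<Rightarrow> real^2) \<Rightarrow> real \<Rightarrow> real \<Rightarrow> real \<Rightarrow> ('k \<Rightarrow> real) \<Rightarrow> ('k \<Rightarrow> real) \<Rightarrow> bool" where
  "nash_equilibrium K loc \<beta> B P_upper P0 P \<longleftrightarrow>
     (\<forall>j \<in> K - players K loc B. P j = P0 j) \<and>
     (\<forall>i \<in> players K loc B.
        is_arg_max (\<lambda>p. payoff K loc \<beta> (P(i := p)) i) (\<lambda>p. p \<in> {0..P_upper}) (P i))"

text \<open>
  Company \<open>i\<close> has a \<open>hidden rival\<close> if some company with market area zero ties for the lowest
  aggregate price along a whole segment of the boundary of \<open>i\<close>. This happens only when the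
  rival lies on the straight line between \<open>i\<close> and a surviving company and its price is exactly
  the one at which it is about to enter the market. The area of \<open>i\<close> then has different one-sided
  derivatives in the price of \<open>i\<close>: the rival bounds \<open>i\<close> after a price increase but not after a
  decrease, so a best response may sit at this kink and violate the first-order condition.
\<close>

definition hidden_rival ::
  "'k set \<Rightarrow> ('k \<Rightarrow> real^2) \<Rightarrow> real \<Rightarrow> ('k \<Rightarrow> real) \<Rightarrow> 'k \<Rightarrow> bool" where
  "hidden_rival K loc \<beta> P i \<longleftrightarrow>
     (\<exists>k \<in> K - surviving K loc \<beta> P. \<exists>a b. a \<noteq> b \<and>
        closed_segment a b \<subseteq> boundary K loc \<beta> P i \<inter> {x. k \<in> owners K loc \<beta> P x})"

end

theory Submission
  imports Defs
begin

text \<open>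
  The market cell of \<open>i\<close> is cut out by the half-planes \<open>direction loc i k \<bullet> x \<le> level loc P i k\<close>,
  and lowering the price of \<open>i\<close> by \<open>2 * t\<close> relaxes all of them by the same \<open>t\<close>. Hence the edge
  shared with a neighbor \<open>j\<close> moves by \<open>t / d\<^sub>i\<^sub>j\<close> and the area grows at the rate \<open>\<Sum>\<^sub>j l\<^sub>i\<^sub>j / d\<^sub>i\<^sub>j\<close>.
  Only lower bounds on the area, for \<open>t\<close> of either sign, are needed: at a maximizer of
  the payoff in the interior of \<open>{0..P_upper}\<close> each of them yields one half of the first-order
  condition. After a price cut, rectangles over the edges that violate exactly one of the old
  constraints are disjoint and lie in the new cell; after a rise, what is lost lies in thin strips
  along the edges. The two bounds involve the same edges because without a hidden rival no edge of
  positive length is shared with a company of area zero, and three surviving companies never tie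
  along a segment. The equilibrium price is interior: some small price always gives a positive
  payoff, and halving the price \<open>P_upper\<close> at least quadruples the area once
  \<open>P_upper > 96 * r\<^sup>2\<close>.
\<close>

section \<open>Rectangles and segments in the plane\<close>

text \<open>A quarter turn of \<open>v\<close>, normalised, so it runs along the lines with normal
  \<open>v\<close>. For nonzero \<open>v\<close>, it and \<open>v /\<^sub>R norm v\<close> form the
  orthonormal frame of the edge computations below.\<close>

definition unit_normal :: "real^2 \<Rightarrow> real^2" where
  "unit_normal v = vector [- (v $ 2), v $ 1] /\<^sub>R norm v"

lemma unit_normal_orthogonal: "unit_normal v \<bullet> v = 0"
  by (simp add: unit_normal_def inner_vec_def sum_2)

lemma norm_vec2: "norm (x :: real^2) = sqrt ((x $ 1)\<^sup>2 + (x $ 2)\<^sup>2)"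
  by (simp add: norm_vec_def L2_set_def sum_2)

lemma norm_unit_normal: "norm (unit_normal v) = 1" if "v \<noteq> 0"
proof -
  have "norm (vector [- (v $ 2), v $ 1] :: real^2) = norm v"
    by (simp add: norm_vec2 add.commute)
  with that show ?thesis by (simp add: unit_normal_def)
qed

text \<open>A square matrix with orthonormal rows has orthonormal columns; facts \<open>1\<close>,
  \<open>2\<close> and \<open>3\<close> are these column relations.\<close>

lemma orthonormal_expansion:
  fixes x :: "real^2"
  assumes "norm u = 1" "norm w = 1" "u \<bullet> w = 0"
  shows "x = (x \<bullet> u) *\<^sub>R u + (x \<bullet> w) *\<^sub>R w"
proof -
  have uu: "u$1 * u$1 + u$2 * u$2 = 1" and ww: "w$1 * w$1 + w$2 * w$2 = 1"
    and uw: "u$1 * w$1 + u$2 * w$2 = 0"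
    using assms by (auto simp: norm_eq_1 inner_vec_def sum_2)
  have 1: "u$1 * u$1 + w$1 * w$1 = 1" and 2: "u$2 * u$2 + w$2 * w$2 = 1"
    and 3: "u$1 * u$2 + w$1 * w$2 = 0"
    using uu ww uw by algebra+
  show ?thesis
    unfolding vec_eq_iff forall_2 inner_vec_def sum_2 using 1 2 3
    by (simp; algebra)
qed

text \<open>Each rectangle is the image of an axis-parallel box under an isometry. The closed form
  will bound thin strips from above, the open form will fit inside a grown cell.\<close>

lemma rectangle_measure:
  fixes u w :: "real^2"
  assumes uw: "norm u = 1" "norm w = 1" "u \<bullet> w = 0" and "a \<le> b" "c \<le> d"
  shows "{x. a \<le> x \<bullet> u \<and> x \<bullet> u \<le> b \<and> c \<le> x \<bullet> w \<and> x \<bullet> w \<le> d} \<in> lmeasurable" (is ?thesis1)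
    and "measure lebesgue {x. a \<le> x \<bullet> u \<and> x \<bullet> u \<le> b \<and> c \<le> x \<bullet> w \<and> x \<bullet> w \<le> d} = (b - a) * (d - c)" (is ?thesis2)
    and "{x. a < x \<bullet> u \<and> x \<bullet> u < b \<and> c < x \<bullet> w \<and> x \<bullet> w < d} \<in> lmeasurable" (is ?thesis3)
    and "measure lebesgue {x. a < x \<bullet> u \<and> x \<bullet> u < b \<and> c < x \<bullet> w \<and> x \<bullet> w < d} = (b - a) * (d - c)" (is ?thesis4)
proof -
  define f where "f x = x $ 1 *\<^sub>R u + x $ 2 *\<^sub>R w" for x :: "real^2"
  have ip: "u \<bullet> u = 1" "w \<bullet> w = 1" "w \<bullet> u = 0" "u \<bullet> w = 0" using uw by (auto simp: norm_eq_1 inner_commute)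
  have lin: "linear f" by (auto simp: f_def linear_iff algebra_simps)
  have "norm (f x) = norm x" for x
    unfolding norm_eq by (simp add: f_def ip inner_add_left inner_add_right) (simp add: inner_vec_def sum_2)
  with lin have f: "orthogonal_transformation f" by (simp add: orthogonal_transformation)
  have fu: "f x \<bullet> u = x $ 1" "f x \<bullet> w = x $ 2" for x by (auto simp: f_def ip inner_add_left)
  have surj: "x = f (vector [x \<bullet> u, x \<bullet> w])" for x
    using orthonormal_expansion[OF uw, of x] by (simp add: f_def)
  have c: "{x. a \<le> x \<bullet> u \<and> x \<bullet> u \<le> b \<and> c \<le> x \<bullet> w \<and> x \<bullet> w \<le> d} = f ` cbox (vector [a, c]) (vector [b, d])"
    (is "?L = _")
  proof
    show "?L \<subseteq> f ` cbox (vector [a, c]) (vector [b, d])"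
      using surj by (auto intro!: image_eqI[of _ f] simp: mem_box_cart forall_2)
  qed (auto simp: mem_box_cart forall_2 fu)
  have o: "{x. a < x \<bullet> u \<and> x \<bullet> u < b \<and> c < x \<bullet> w \<and> x \<bullet> w < d} = f ` box (vector [a, c]) (vector [b, d])"
    (is "?L = _")
  proof
    show "?L \<subseteq> f ` box (vector [a, c]) (vector [b, d])"
      using surj by (auto intro!: image_eqI[of _ f] simp: mem_box_cart forall_2)
  qed (auto simp: mem_box_cart forall_2 fu)
  have ne: "cbox (vector [a, c]) (vector [b, d] :: real^2) \<noteq> {}"
    using assms(4,5) by (simp add: interval_ne_empty_cart forall_2)
  have m: "measure lebesgue (cbox (vector [a, c]) (vector [b, d] :: real^2)) = (b - a) * (d - c)"
    using content_cbox_cart[OF ne] by (simp add: UNIV_2)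
  show ?thesis1 unfolding c by (intro measurable_orthogonal_image[OF f]) auto
  show ?thesis3 unfolding o by (intro measurable_orthogonal_image[OF f]) auto
  show ?thesis2 unfolding c using m by (subst measure_orthogonal_image[OF f]) auto
  show ?thesis4 unfolding o using m by (subst measure_orthogonal_image[OF f]) (auto simp: measure_lborel_cbox_eq measure_lborel_box_eq)
qed

text \<open>On a line with normal \<open>w\<close> distances are differences of the \<open>u\<close>
  coordinate, so the diameter is the spread of that coordinate, attained by compactness.\<close>

lemma line_extent:
  fixes e :: "(real^2) set"
  assumes uw: "norm u = 1" "norm w = 1" "u \<bullet> w = 0"
    and e: "compact e" "e \<noteq> {}" "\<And>x. x \<in> e \<Longrightarrow> x \<bullet> w = c"
  obtains a b where "a \<in> e" "b \<in> e" "diameter e = b \<bullet> u - a \<bullet> u"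
    "\<And>x. x \<in> e \<Longrightarrow> a \<bullet> u \<le> x \<bullet> u \<and> x \<bullet> u \<le> b \<bullet> u"
proof -
  have cont: "continuous_on e (\<lambda>x. x \<bullet> u)" by (intro continuous_intros)
  obtain a where a: "a \<in> e" "\<And>x. x \<in> e \<Longrightarrow> a \<bullet> u \<le> x \<bullet> u"
    using continuous_attains_inf[OF e(1,2) cont] by blast
  obtain b where b: "b \<in> e" "\<And>x. x \<in> e \<Longrightarrow> x \<bullet> u \<le> b \<bullet> u"
    using continuous_attains_sup[OF e(1,2) cont] by blast
  have "norm (x - y) = \<bar>x \<bullet> u - y \<bullet> u\<bar>" if "x \<in> e" "y \<in> e" for x y
  proof -
    have "(x - y) \<bullet> w = 0"
      using e(3) that by (simp add: inner_diff_left)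
    then have "x - y = ((x - y) \<bullet> u) *\<^sub>R u"
      using orthonormal_expansion[OF uw, of "x - y"] by simp
    then have "norm (x - y) = \<bar>(x - y) \<bullet> u\<bar> * norm u"
      by (metis norm_scaleR)
    then show ?thesis by (simp add: uw inner_diff_left)
  qed
  note dist = this
  have "diameter e \<le> b \<bullet> u - a \<bullet> u"
  proof (rule diameter_le)
    fix x y assume "x \<in> e" "y \<in> e"
    then show "norm (x - y) \<le> b \<bullet> u - a \<bullet> u"
      using dist a(2)[of x] a(2)[of y] b(2)[of x] b(2)[of y] by (auto simp: abs_if)
  qed (use e in auto)
  moreover have "b \<bullet> u - a \<bullet> u \<le> diameter e"
    using diameter_bounded_bound[OF compact_imp_bounded[OF e(1)] b(1) a(1)] dist[OF b(1) a(1)]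
    by (simp add: dist_norm)
  ultimately show thesis using that a b by force
qed

section \<open>Thin strips along an edge\<close>

lemma compact_uniform_slack:
  fixes f :: "'a::topological_space \<Rightarrow> real"
  assumes "compact D" "continuous_on D f" "\<And>x. x \<in> D \<Longrightarrow> f x < h"
  obtains \<delta> where "\<delta> > 0" "\<And>x. x \<in> D \<Longrightarrow> f x \<le> h - \<delta>"
proof (cases "D = {}")
  case True
  then show ?thesis using that[of 1] by simp
next
  case False
  then obtain m where m: "m \<in> D" "\<And>x. x \<in> D \<Longrightarrow> f x \<le> f m"
    using continuous_attains_sup[OF assms(1) False assms(2)] by blast
  then show ?thesis using that[of "h - f m"] assms(3)[of m] by auto
qed

lemma closed_in_lebesgue: "closed S \<Longrightarrow> S \<in> sets lebesgue"
  by (rule sets_completionI_sets) simp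

lemma open_in_lebesgue: "open S \<Longrightarrow> S \<in> sets lebesgue"
  by (rule sets_completionI_sets) simp

text \<open>The part \<open>D\<close> of \<open>C\<close> lying sideways beyond the edge by
  \<open>\<eta>/2\<close> or more is compact and misses the level \<open>h\<close>, hence stays
  below it by a fixed \<open>\<delta>\<close>. For \<open>t < \<delta>\<close> the strip therefore
  fits into a rectangle over the widened edge.\<close>

lemma strip_measure_le:
  fixes v :: "real^2"
  assumes C: "compact C" "\<And>x. x \<in> C \<Longrightarrow> v \<bullet> x \<le> h" and v: "v \<noteq> 0" and \<eta>: "\<eta> > 0"
  shows "\<forall>\<^sub>F t in at_right 0.
    measure lebesgue {x \<in> C. h - t < v \<bullet> x} \<le> t * ((diameter {x \<in> C. v \<bullet> x = h} + \<eta>) / norm v)"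
proof -
  define e where "e = {x \<in> C. v \<bullet> x = h}"
  define u where "u = unit_normal v"
  define w where "w = v /\<^sub>R norm v"
  have uw: "norm u = 1" "norm w = 1" "u \<bullet> w = 0"
    using v norm_unit_normal unit_normal_orthogonal by (auto simp: u_def w_def)
  have xw: "x \<bullet> w = (v \<bullet> x) / norm v" for x
    by (simp add: w_def inner_commute divide_inverse_commute)
  have ce: "compact e"
  proof -
    have "e = C \<inter> {x. v \<bullet> x = h}" by (auto simp: e_def)
    then show ?thesis using C(1) closed_hyperplane compact_Int_closed by metis
  qed
  \<comment> \<open>An empty edge has diameter 0, and the degenerate interval at 0 then plays the
    role of its extent.\<close>
  obtain m M where mM: "m \<le> M" "diameter e = M - m" "\<And>x. x \<in> e \<Longrightarrow> m \<le> x \<bullet> u \<and> x \<bullet> u \<le> M"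
  proof (cases "e = {}")
    case True
    then show ?thesis using that[of 0 0] by simp
  next
    case False
    have c: "x \<bullet> w = h / norm v" if "x \<in> e" for x using that by (auto simp: e_def xw)
    obtain a b where "a \<in> e" "b \<in> e" "diameter e = b \<bullet> u - a \<bullet> u"
      "\<And>x. x \<in> e \<Longrightarrow> a \<bullet> u \<le> x \<bullet> u \<and> x \<bullet> u \<le> b \<bullet> u"
      using line_extent[OF uw ce False c] by metis
    then show ?thesis using that[of "a \<bullet> u" "b \<bullet> u"] by force
  qed
  define D where "D = C \<inter> ({x. x \<bullet> u \<le> m - \<eta>/2} \<union> {x. x \<bullet> u \<ge> M + \<eta>/2})"
  have "compact D"
    unfolding D_def by (intro compact_Int_closed C closed_Un)
      (auto intro!: closed_Collect_le continuous_intros)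
  moreover have "v \<bullet> x < h" if "x \<in> D" for x
  proof -
    have "x \<in> C" "x \<notin> e" using that mM(3)[of x] \<eta> by (auto simp: D_def)
    then show ?thesis using C(2)[of x] by (auto simp: e_def)
  qed
  moreover have "continuous_on D (\<lambda>x. v \<bullet> x)" by (intro continuous_intros)
  ultimately obtain \<delta> where \<delta>: "\<delta> > 0" "\<And>x. x \<in> D \<Longrightarrow> v \<bullet> x \<le> h - \<delta>"
    using compact_uniform_slack[of D "\<lambda>x. v \<bullet> x" h] by blast
  have "measure lebesgue {x \<in> C. h - t < v \<bullet> x} \<le> t * ((diameter e + \<eta>) / norm v)"
    if t: "0 < t" "t < \<delta>" for t
  proof -
    have mn: "m - \<eta>/2 \<le> M + \<eta>/2" "(h - t) / norm v \<le> h / norm v"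
      using mM(1) \<eta> t v by (auto simp: divide_right_mono)
    let ?R = "{x. m - \<eta>/2 \<le> x \<bullet> u \<and> x \<bullet> u \<le> M + \<eta>/2 \<and> (h - t) / norm v \<le> x \<bullet> w \<and> x \<bullet> w \<le> h / norm v}"
    have "{x \<in> C. h - t < v \<bullet> x} \<subseteq> ?R"
    proof clarify
      fix x assume x: "x \<in> C" "h - t < v \<bullet> x"
      then have "x \<notin> D" using \<delta>(2)[of x] t by auto
      then show "m - \<eta>/2 \<le> x \<bullet> u \<and> x \<bullet> u \<le> M + \<eta>/2 \<and> (h - t) / norm v \<le> x \<bullet> w \<and> x \<bullet> w \<le> h / norm v"
        using x C(2)[of x] v by (auto simp: D_def xw divide_right_mono)
    qed
    moreover have "{x \<in> C. h - t < v \<bullet> x} \<in> sets lebesgue"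
    proof -
      have "{x \<in> C. h - t < v \<bullet> x} = C \<inter> {x. h - t < v \<bullet> x}" by auto
      moreover have "open {x. h - t < v \<bullet> x}" by (intro open_Collect_less continuous_intros)
      ultimately show ?thesis
        using C(1) by (simp add: sets.Int closed_in_lebesgue open_in_lebesgue compact_imp_closed)
    qed
    ultimately have "measure lebesgue {x \<in> C. h - t < v \<bullet> x} \<le> measure lebesgue ?R"
      by (intro measure_mono_fmeasurable rectangle_measure(1)[OF uw mn])
    also have "\<dots> = (M + \<eta>/2 - (m - \<eta>/2)) * (h / norm v - (h - t) / norm v)"
      by (rule rectangle_measure(2)[OF uw mn])
    also have "M + \<eta>/2 - (m - \<eta>/2) = diameter e + \<eta>"
      by (simp add: mM(2))
    also have "h / norm v - (h - t) / norm v = t / norm v"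
      by (simp add: diff_divide_distrib)
    also have "(diameter e + \<eta>) * (t / norm v) = t * ((diameter e + \<eta>) / norm v)"
      by simp
    finally show ?thesis .
  qed
  then show ?thesis
    unfolding e_def[symmetric] eventually_at_right_field using \<delta>(1) by auto
qed

section \<open>Length of a segment as its diameter\<close>

lemma diameter_closed_segment:
  fixes a :: "'a::euclidean_space"
  shows "diameter (closed_segment a b) = dist a b"
proof (rule antisym)
  show "diameter (closed_segment a b) \<le> dist a b"
  proof (rule diameter_le)
    fix x y assume "x \<in> closed_segment a b" "y \<in> closed_segment a b"
    then obtain s t where st: "x = (1 - s) *\<^sub>R a + s *\<^sub>R b" "0 \<le> s" "s \<le> 1"
      "y = (1 - t) *\<^sub>R a + t *\<^sub>R b" "0 \<le> t" "t \<le> 1"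
      by (auto simp: in_segment)
    have "x - y = (t - s) *\<^sub>R (a - b)" unfolding st by (simp add: algebra_simps)
    then have "norm (x - y) = \<bar>t - s\<bar> * norm (a - b)" by simp
    also have "\<dots> \<le> 1 * norm (a - b)" using st by (intro mult_right_mono) auto
    finally show "norm (x - y) \<le> dist a b" by (simp add: dist_norm)
  qed simp
  show "dist a b \<le> diameter (closed_segment a b)"
    by (simp add: diameter_bounded_bound bounded_closed_segment)
qed

text \<open>The endpoints are not determined by the set up to order, but the diameter recovers their
  distance from the set alone, so the definite description is well defined.\<close>

lemma segment_length_closed_segment: "segment_length (closed_segment a b) = dist a b"
  unfolding segment_length_def
proof (rule the_equality)
  fix l assume "\<exists>c d. closed_segment a b = closed_segment c d \<and> l = dist c d"
  then show "l = dist a b" by (metis diameter_closed_segment)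
qed blast

text \<open>A nonempty compact convex subset of a line is a closed segment. This lets the edge
  estimates, which speak of diameters, be read as statements on border lengths.\<close>

lemma segment_length_eq_diameter:
  fixes e :: "(real^2) set"
  assumes "compact e" "convex e" "e \<noteq> {}" "v \<noteq> 0" and line: "\<And>x. x \<in> e \<Longrightarrow> v \<bullet> x = c"
  shows "segment_length e = diameter e"
proof -
  define u where "u = unit_normal v"
  define w where "w = v /\<^sub>R norm v"
  have uw: "norm u = 1" "norm w = 1" "u \<bullet> w = 0"
    using assms(4) norm_unit_normal unit_normal_orthogonal by (auto simp: u_def w_def)
  have "\<exists>s. x - y = s *\<^sub>R u" if "x \<in> e" "y \<in> e" for x y
  proof -
    have "v \<bullet> (x - y) = 0" using line that by (simp add: inner_diff_right)
    then have "(x - y) \<bullet> w = 0" by (simp add: w_def inner_commute)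
    then show ?thesis using orthonormal_expansion[OF uw, of "x - y"] by auto
  qed
  then have "collinear e" unfolding collinear_def by blast
  then obtain a b where "e = closed_segment a b"
    using compact_convex_collinear_segment assms by blast
  then show ?thesis by (simp add: segment_length_closed_segment diameter_closed_segment)
qed

lemma orthogonal_parallel_2:
  fixes a b c :: "real^2"
  assumes "c \<noteq> 0" "a \<noteq> 0" "a \<bullet> c = 0" "b \<bullet> c = 0"
  obtains l where "b = l *\<^sub>R a"
proof -
  define u where "u = unit_normal c"
  define w where "w = c /\<^sub>R norm c"
  have uw: "norm u = 1" "norm w = 1" "u \<bullet> w = 0"
    using assms(1) norm_unit_normal unit_normal_orthogonal by (auto simp: u_def w_def)
  have "a = (a \<bullet> u) *\<^sub>R u" "b = (b \<bullet> u) *\<^sub>R u"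
    using orthonormal_expansion[OF uw, of a] orthonormal_expansion[OF uw, of b] assms by (auto simp: w_def)
  moreover from this have "a \<bullet> u \<noteq> 0" using assms(2) by force
  ultimately have "b = ((b \<bullet> u) / (a \<bullet> u)) *\<^sub>R a"
    by (metis nonzero_eq_divide_eq scaleR_scaleR)
  then show thesis using that by blast
qed

section \<open>Area of a cell under a shift of its constraints\<close>

text \<open>The normals \<open>v k\<close> are not normalised: one common \<open>t\<close> models a
  price change, and the line of constraint \<open>k\<close> then moves by
  \<open>t / norm (v k)\<close>.\<close>

definition cell :: "'k set \<Rightarrow> ('k \<Rightarrow> 'a::euclidean_space) \<Rightarrow> ('k \<Rightarrow> real) \<Rightarrow> real \<Rightarrow> 'a set" where
  "cell I v h t = {x. \<forall>k\<in>I. v k \<bullet> x \<le> h k + t}"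

definition edge :: "'k set \<Rightarrow> ('k \<Rightarrow> 'a::euclidean_space) \<Rightarrow> ('k \<Rightarrow> real) \<Rightarrow> 'k \<Rightarrow> 'a set" where
  "edge I v h k = {x \<in> cell I v h 0. v k \<bullet> x = h k}"

text \<open>On a bounded set only finitely many constraints have slack below \<open>s\<close>
  somewhere. This reduces an infinite family of companies to a finite one wherever areas are
  estimated.\<close>

definition locally_finite_constraints ::
  "'k set \<Rightarrow> ('k \<Rightarrow> 'a::euclidean_space) \<Rightarrow> ('k \<Rightarrow> real) \<Rightarrow> bool" where
  "locally_finite_constraints I v h \<longleftrightarrow>
     (\<forall>A s. bounded A \<longrightarrow> finite {k \<in> I. \<exists>x\<in>A. h k - s < v k \<bullet> x})"

lemma cell_eq_INT: "cell I v h t = (\<Inter>k\<in>I. {x. v k \<bullet> x \<le> h k + t})"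
  by (auto simp: cell_def)

lemma closed_cell: "closed (cell I v h t)"
  unfolding cell_eq_INT by (intro closed_INT ballI closed_halfspace_le)

lemma convex_cell: "convex (cell I v h t)"
  unfolding cell_eq_INT by (intro convex_INT ballI convex_halfspace_le)

lemma edge_eq_Int: "edge I v h k = cell I v h 0 \<inter> {x. v k \<bullet> x = h k}"
  by (auto simp: edge_def)

lemma convex_edge: "convex (edge I v h k)"
  unfolding edge_eq_Int by (intro convex_Int convex_cell convex_hyperplane)

lemma compact_cell: "bounded (cell I v h t) \<Longrightarrow> compact (cell I v h t)"
  using closed_cell compact_eq_bounded_closed by blast

lemma compact_edge: "bounded (cell I v h 0) \<Longrightarrow> compact (edge I v h k)"
  unfolding edge_eq_Int by (intro compact_Int_closed compact_cell closed_hyperplane)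

text \<open>The lost part is covered by strips \<open>T k t\<close> along the edges, so
  subadditivity suffices and overlaps at corners do no harm. Edges of diameter 0 contribute only to
  the error term.\<close>

lemma measure_cell_shrink:
  fixes v :: "'k \<Rightarrow> real^2"
  assumes lf: "locally_finite_constraints I v h"
    and v: "\<And>k. k \<in> I \<Longrightarrow> v k \<noteq> 0"
    and bdd: "\<And>t. bounded (cell I v h t)"
    and N: "finite N" "N \<subseteq> I" "\<And>k. k \<in> I - N \<Longrightarrow> diameter (edge I v h k) = 0"
    and \<eta>: "\<eta> > 0"
  shows "\<forall>\<^sub>F t in at_right 0. measure lebesgue (cell I v h 0)
           - t * ((\<Sum>k\<in>N. diameter (edge I v h k) / norm (v k)) + \<eta>) \<le> measure lebesgue (cell I v h (- t))"
proof -
  define C where "C = cell I v h"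
  \<comment> \<open>Slack 1 is enough because only \<open>t < 1\<close> is considered.
    \<open>N\<close> is joined so that the sum over \<open>J\<close> can be cut down to
    \<open>N\<close>.\<close>
  define J where "J = N \<union> {k \<in> I. \<exists>x\<in>C 0. h k - 1 < v k \<bullet> x}"
  have J: "finite J" "J \<subseteq> I" "N \<subseteq> J"
    using N lf bdd by (auto simp: J_def C_def locally_finite_constraints_def)
  define T where "T k t = {x \<in> C 0. h k - t < v k \<bullet> x}" for k t
  define s where "s = (\<Sum>k\<in>J. 1 / norm (v k))"
  have s: "s \<ge> 0" by (simp add: s_def sum_nonneg)
  \<comment> \<open>The error \<open>\<eta>\<close> is shared among the finitely many edges; the
    summand 1 keeps the denominator positive when \<open>s = 0\<close>.\<close>
  define \<eta>' where "\<eta>' = \<eta> / (1 + s)"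
  have \<eta>': "\<eta>' > 0" "\<eta>' * s \<le> \<eta>"
    using \<eta> s by (auto simp: \<eta>'_def field_simps)
  have e: "edge I v h k = {x \<in> C 0. v k \<bullet> x = h k}" for k by (auto simp: edge_def C_def)
  have "\<forall>\<^sub>F t in at_right 0. measure lebesgue (T k t) \<le> t * ((diameter (edge I v h k) + \<eta>') / norm (v k))"
    if "k \<in> J" for k
  proof -
    have "compact (C 0)" "v k \<noteq> 0" "\<And>x. x \<in> C 0 \<Longrightarrow> v k \<bullet> x \<le> h k"
      using that J v compact_cell[OF bdd, of 0] by (auto simp: C_def cell_def)
    then show ?thesis
      unfolding T_def e using strip_measure_le \<eta>'(1) by blast
  qed
  then have "\<forall>\<^sub>F t in at_right 0. \<forall>k\<in>J. measure lebesgue (T k t) \<le> t * ((diameter (edge I v h k) + \<eta>') / norm (v k))"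
    using J(1) by (simp add: eventually_ball_finite)
  moreover have "\<forall>\<^sub>F t in at_right 0. 0 < t \<and> t < (1::real)"
    unfolding eventually_at_right_field by (intro exI[of _ 1]) auto
  ultimately show ?thesis
  proof eventually_elim
    case (elim t)
    have meas: "T k t \<in> lmeasurable" for k
    proof -
      have "T k t = C 0 - {x. v k \<bullet> x \<le> h k - t}" by (auto simp: T_def)
      moreover have "closed {x. v k \<bullet> x \<le> h k - t}" by (rule closed_halfspace_le)
      moreover have "C 0 \<in> lmeasurable" by (simp add: C_def bdd compact_cell lmeasurable_compact)
      ultimately show ?thesis
        by (simp add: fmeasurable_Diff closed_in_lebesgue)
    qed
    have mC: "C s \<in> lmeasurable" for s by (simp add: C_def bdd compact_cell lmeasurable_compact)
    have "C 0 \<subseteq> C (- t) \<union> (\<Union>k\<in>J. T k t)"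
    proof
      fix x assume x: "x \<in> C 0"
      show "x \<in> C (- t) \<union> (\<Union>k\<in>J. T k t)"
      proof (cases "x \<in> C (- t)")
        case False
        then obtain k where k: "k \<in> I" "h k - t < v k \<bullet> x" by (auto simp: C_def cell_def)
        then have "h k - 1 < v k \<bullet> x" using elim by simp
        then have "k \<in> J" using k x by (auto simp: J_def)
        then show ?thesis using k x by (auto simp: T_def)
      qed auto
    qed
    then have "measure lebesgue (C 0) \<le> measure lebesgue (C (- t) \<union> (\<Union>k\<in>J. T k t))"
      using mC meas J by (intro measure_mono_fmeasurable fmeasurable.Un fmeasurable.finite_UN) auto
    also have "\<dots> \<le> measure lebesgue (C (- t)) + measure lebesgue (\<Union>k\<in>J. T k t)"
      using mC meas J by (intro measure_Un_le) auto
    also have "measure lebesgue (\<Union>k\<in>J. T k t) \<le> (\<Sum>k\<in>J. measure lebesgue (T k t))"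
      using meas J by (intro measure_UNION_le) auto
    also have "\<dots> \<le> (\<Sum>k\<in>J. t * ((diameter (edge I v h k) + \<eta>') / norm (v k)))"
      using elim by (intro sum_mono) auto
    also have "\<dots> = t * ((\<Sum>k\<in>J. diameter (edge I v h k) / norm (v k)) + \<eta>' * s)"
      by (simp add: s_def sum_distrib_left distrib_left sum.distrib add_divide_distrib)
    also have "(\<Sum>k\<in>J. diameter (edge I v h k) / norm (v k)) = (\<Sum>k\<in>N. diameter (edge I v h k) / norm (v k))"
      using J N by (intro sum.mono_neutral_right) auto
    also have "t * ((\<Sum>k\<in>N. diameter (edge I v h k) / norm (v k)) + \<eta>' * s) \<le> t * ((\<Sum>k\<in>N. diameter (edge I v h k) / norm (v k)) + \<eta>)"
      using \<eta>' elim by (intro mult_left_mono) auto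
    finally show ?case by (simp add: C_def)
  qed
qed

text \<open>The part of the cell grown by \<open>t\<close> that violates exactly the \<open>k\<close>-th of the original
  constraints contains a rectangle of height \<open>t / norm (v k)\<close> over almost the whole edge.\<close>

lemma measure_outer_strip_ge:
  fixes v :: "'k \<Rightarrow> real^2"
  assumes lf: "locally_finite_constraints I v h"
    and v: "v k \<noteq> 0"
    and bdd: "\<And>t. bounded (cell I v h t)"
    and k: "k \<in> I"
    and generic: "\<And>j x y. j \<in> I \<Longrightarrow> j \<noteq> k \<Longrightarrow> x \<in> edge I v h k \<inter> edge I v h j \<Longrightarrow>
                    y \<in> edge I v h k \<inter> edge I v h j \<Longrightarrow> x = y"
    and \<eta>: "\<eta> > 0"
  defines "Q \<equiv> \<lambda>t. cell (I - {k}) v h 0 \<inter> {x. h k < v k \<bullet> x \<and> v k \<bullet> x \<le> h k + t}"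
  shows "\<forall>\<^sub>F t in at_right 0. Q t \<in> lmeasurable \<and>
           t * ((diameter (edge I v h k) - \<eta>) / norm (v k)) \<le> measure lebesgue (Q t)"
proof -
  have Qm: "Q t \<in> lmeasurable" if "t > 0" for t
  proof (rule bounded_set_imp_lmeasurable)
    have "Q t \<subseteq> cell I v h t"
    proof
      fix x assume x: "x \<in> Q t"
      show "x \<in> cell I v h t" unfolding cell_def
      proof safe
        fix j assume "j \<in> I"
        then show "v j \<bullet> x \<le> h j + t"
          using x that by (cases "j = k") (force simp: Q_def cell_def)+
      qed
    qed
    then show "bounded (Q t)" using bdd bounded_subset by blast
    have "Q t = cell (I - {k}) v h 0 \<inter> {x. h k < v k \<bullet> x} \<inter> {x. v k \<bullet> x \<le> h k + t}"
      by (auto simp: Q_def)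
    moreover have "open {x. h k < v k \<bullet> x}" by (intro open_Collect_less continuous_intros)
    ultimately show "Q t \<in> sets lebesgue"
      using closed_cell[of "I - {k}" v h 0] closed_halfspace_le[of "v k" "h k + t"]
      by (simp add: sets.Int closed_in_lebesgue open_in_lebesgue)
  qed
  define e where "e = edge I v h k"
  show ?thesis
  \<comment> \<open>For a short edge the claimed lower bound is not positive, so nothing has to be
    constructed.\<close>
  proof (cases "diameter e \<le> \<eta>")
    case True
    have "t * ((diameter e - \<eta>) / norm (v k)) \<le> measure lebesgue (Q t)" if "t > 0" for t
    proof -
      have "t * ((diameter e - \<eta>) / norm (v k)) \<le> 0"
        using that True by (simp add: mult_nonneg_nonpos divide_nonpos_nonneg)
      then show ?thesis using measure_nonneg order_trans by blast
    qed
    then show ?thesis unfolding e_def[symmetric] eventually_at_right_field using Qm by (intro exI[of _ 1]) auto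
  next
    case False
    define u where "u = unit_normal (v k)"
    define w where "w = v k /\<^sub>R norm (v k)"
    have uw: "norm u = 1" "norm w = 1" "u \<bullet> w = 0"
      using v norm_unit_normal unit_normal_orthogonal by (auto simp: u_def w_def)
    have ip: "u \<bullet> u = 1" "w \<bullet> w = 1" "w \<bullet> u = 0" "u \<bullet> w = 0"
      using uw by (auto simp: norm_eq_1 inner_commute)
    have xw: "x \<bullet> w = (v k \<bullet> x) / norm (v k)" for x
      by (simp add: w_def inner_commute divide_inverse_commute)
    have "e \<noteq> {}" using False \<eta> by auto
    moreover have "x \<bullet> w = h k / norm (v k)" if "x \<in> e" for x using that by (auto simp: e_def edge_def xw)
    moreover have "compact e" unfolding e_def by (rule compact_edge[OF bdd])
    ultimately obtain a b where ab: "a \<in> e" "b \<in> e" "diameter e = b \<bullet> u - a \<bullet> u"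
      using line_extent[OF uw] by metis
    define \<sigma> where "\<sigma> = \<eta> / 2"
    define c where "c = h k / norm (v k)"
    have \<sigma>: "\<sigma> > 0" "a \<bullet> u + \<sigma> \<le> b \<bullet> u - \<sigma>" using \<eta> False ab(3) by (auto simp: \<sigma>_def)
    \<comment> \<open>\<open>D\<close> is the edge trimmed by \<open>\<eta> / 2\<close> at both
      ends, written as a rectangle of height 0. \<open>A\<close> is a fixed bounded rectangle that
      contains \<open>R t\<close> for all \<open>t < 1\<close>.\<close>
    define D where "D = {x. a \<bullet> u + \<sigma> \<le> x \<bullet> u \<and> x \<bullet> u \<le> b \<bullet> u - \<sigma> \<and> c \<le> x \<bullet> w \<and> x \<bullet> w \<le> c}"
    define A where "A = {x. a \<bullet> u + \<sigma> \<le> x \<bullet> u \<and> x \<bullet> u \<le> b \<bullet> u - \<sigma> \<and> c \<le> x \<bullet> w \<and> x \<bullet> w \<le> c + 1 / norm (v k)}"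
    have "bounded A"
      unfolding bounded_iff
    proof (intro exI ballI)
      fix x assume "x \<in> A"
      have "norm x = norm ((x \<bullet> u) *\<^sub>R u + (x \<bullet> w) *\<^sub>R w)" using orthonormal_expansion[OF uw] by metis
      also have "\<dots> \<le> \<bar>x \<bullet> u\<bar> + \<bar>x \<bullet> w\<bar>" using norm_triangle_ineq[of "(x \<bullet> u) *\<^sub>R u" "(x \<bullet> w) *\<^sub>R w"] by (simp add: uw)
      also have "\<dots> \<le> \<bar>a \<bullet> u + \<sigma>\<bar> + \<bar>b \<bullet> u - \<sigma>\<bar> + \<bar>c\<bar> + \<bar>c + 1 / norm (v k)\<bar>"
        using \<open>x \<in> A\<close> by (auto simp: A_def)
      finally show "norm x \<le> \<bar>a \<bullet> u + \<sigma>\<bar> + \<bar>b \<bullet> u - \<sigma>\<bar> + \<bar>c\<bar> + \<bar>c + 1 / norm (v k)\<bar>" .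
    qed
    moreover have "D \<subseteq> A" unfolding A_def D_def by (auto intro: order_trans)
    moreover have "closed D"
      unfolding D_def by (intro closed_Collect_conj closed_Collect_le continuous_intros)
    ultimately have "compact D" using bounded_subset compact_eq_bounded_closed by blast
    \<comment> \<open>A point of \<open>D\<close> lies strictly between \<open>a\<close> and
      \<open>b\<close>. Constraint \<open>j\<close> cannot be tight at both ends by
      \<open>generic\<close>, so it is strict in between.\<close>
    have slack: "v j \<bullet> y < h j" if y: "y \<in> D" and j: "j \<in> I" "j \<noteq> k" for y j
    proof -
      define s where "s = (y \<bullet> u - a \<bullet> u) / (b \<bullet> u - a \<bullet> u)"
      have s: "0 < s" "s < 1" using y \<sigma> by (auto simp: s_def D_def)
      have "s * (b \<bullet> u - a \<bullet> u) = y \<bullet> u - a \<bullet> u" using \<sigma> by (simp add: s_def)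
      moreover have "a \<bullet> w = c" "b \<bullet> w = c" "y \<bullet> w = c"
        using ab y by (auto simp: e_def edge_def xw c_def D_def)
      ultimately have "(y - ((1 - s) *\<^sub>R a + s *\<^sub>R b)) \<bullet> u = 0" "(y - ((1 - s) *\<^sub>R a + s *\<^sub>R b)) \<bullet> w = 0"
        by (simp_all add: inner_diff_left inner_add_left algebra_simps)
      then have "y - ((1 - s) *\<^sub>R a + s *\<^sub>R b) = 0"
        using orthonormal_expansion[OF uw, of "y - ((1 - s) *\<^sub>R a + s *\<^sub>R b)"] by simp
      then have y_eq: "v j \<bullet> y = (1 - s) * (v j \<bullet> a) + s * (v j \<bullet> b)"
        by (simp add: inner_add_right)
      have le: "v j \<bullet> a \<le> h j" "v j \<bullet> b \<le> h j" using ab j by (auto simp: e_def edge_def cell_def)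
      have "a \<noteq> b" using \<sigma> by auto
      then have "\<not> (v j \<bullet> a = h j \<and> v j \<bullet> b = h j)"
        using generic[OF j, of a b] ab by (auto simp: e_def edge_def)
      then have "(1 - s) * (h j - v j \<bullet> a) > 0 \<or> s * (h j - v j \<bullet> b) > 0"
        using le s by auto
      moreover have "(1 - s) * (h j - v j \<bullet> a) \<ge> 0" "s * (h j - v j \<bullet> b) \<ge> 0"
        using le s by auto
      ultimately have "(1 - s) * (h j - v j \<bullet> a) + s * (h j - v j \<bullet> b) > 0" by linarith
      then show ?thesis unfolding y_eq by (simp add: algebra_simps)
    qed
    \<comment> \<open>Constraints outside \<open>J\<close> hold on all of \<open>A\<close>. The form
      \<open>h j - 0\<close> is the local finiteness condition at \<open>s = 0\<close>.\<close>
    define J where "J = {j \<in> I. \<exists>x\<in>A. h j - 0 < v j \<bullet> x} - {k}"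
    have J: "finite J" "J \<subseteq> I" "k \<notin> J"
      using lf \<open>bounded A\<close> unfolding locally_finite_constraints_def J_def by blast+
    define R where "R t = {x. a \<bullet> u + \<sigma> < x \<bullet> u \<and> x \<bullet> u < b \<bullet> u - \<sigma> \<and> c < x \<bullet> w \<and> x \<bullet> w < c + t / norm (v k)}" for t
    have "\<forall>\<^sub>F t in at_right 0. \<forall>x\<in>R t. v j \<bullet> x \<le> h j" if "j \<in> J" for j
    proof -
      have "continuous_on D (\<lambda>x. v j \<bullet> x)" by (intro continuous_intros)
      moreover have "v j \<bullet> x < h j" if "x \<in> D" for x
        using slack[OF that] \<open>j \<in> J\<close> J by blast
      ultimately obtain \<delta> where \<delta>: "\<delta> > 0" "\<And>x. x \<in> D \<Longrightarrow> v j \<bullet> x \<le> h j - \<delta>"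
        using compact_uniform_slack[OF \<open>compact D\<close>] by blast
      \<comment> \<open>Going up from the edge by at most \<open>t / norm (v k)\<close> raises
        \<open>v j \<bullet> x\<close> by at most \<open>t * norm (v j) / norm (v k)\<close>, which
        stays below the slack \<open>\<delta>\<close> for \<open>t < \<tau>\<close>. The point
        \<open>y\<close> below is the foot of \<open>x\<close> on the edge.\<close>
      define \<tau> where "\<tau> = \<delta> * norm (v k) / (1 + norm (v j))"
      have pos: "1 + norm (v j) > 0" by (simp add: add_pos_nonneg)
      then have \<tau>: "\<tau> > 0" using \<delta> v by (simp add: \<tau>_def)
      have "v j \<bullet> x \<le> h j" if t: "0 < t" "t < \<tau>" and x: "x \<in> R t" for t x
      proof -
        define y where "y = x - (x \<bullet> w - c) *\<^sub>R w"
        have "y \<in> D" using x by (auto simp: y_def D_def R_def inner_diff_left ip)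
        have "v j \<bullet> x = v j \<bullet> y + (x \<bullet> w - c) * (v j \<bullet> w)" by (simp add: y_def inner_diff_right)
        also have "(x \<bullet> w - c) * (v j \<bullet> w) \<le> (t / norm (v k)) * norm (v j)"
        proof -
          have "v j \<bullet> w \<le> norm (v j)" using norm_cauchy_schwarz[of "v j" w] uw by simp
          then have "(x \<bullet> w - c) * (v j \<bullet> w) \<le> (x \<bullet> w - c) * norm (v j)"
            using x by (intro mult_left_mono) (auto simp: R_def)
          also have "\<dots> \<le> (t / norm (v k)) * norm (v j)"
            using x by (intro mult_right_mono) (auto simp: R_def)
          finally show ?thesis .
        qed
        also have "(t / norm (v k)) * norm (v j) \<le> \<delta>"
        proof -
          have "t * norm (v j) \<le> t * (1 + norm (v j))" using t by simp
          also have "\<dots> \<le> \<delta> * norm (v k)" using t pos by (simp add: \<tau>_def pos_less_divide_eq)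
          finally show ?thesis using v by (simp add: field_simps)
        qed
        finally show ?thesis using \<delta>(2)[OF \<open>y \<in> D\<close>] by simp
      qed
      then show ?thesis unfolding eventually_at_right_field using \<tau> by auto
    qed
    then have "\<forall>\<^sub>F t in at_right 0. \<forall>j\<in>J. \<forall>x\<in>R t. v j \<bullet> x \<le> h j"
      using J(1) by (simp add: eventually_ball_finite)
    moreover have "\<forall>\<^sub>F t in at_right 0. 0 < t \<and> t < (1::real)"
      unfolding eventually_at_right_field by (intro exI[of _ 1]) auto
    ultimately show ?thesis
    proof eventually_elim
      case (elim t)
      have mn: "a \<bullet> u + \<sigma> \<le> b \<bullet> u - \<sigma>" "c \<le> c + t / norm (v k)" using \<sigma> elim by auto
      have "R t \<subseteq> A"
      proof -
        have "t / norm (v k) \<le> 1 / norm (v k)" using elim by (simp add: divide_right_mono)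
        then show ?thesis by (auto simp: R_def A_def)
      qed
      have "R t \<subseteq> Q t"
      proof
        fix x assume x: "x \<in> R t"
        have "v j \<bullet> x \<le> h j" if "j \<in> I - {k}" for j
          using elim x that \<open>R t \<subseteq> A\<close> by (cases "j \<in> J") (auto simp: J_def not_less)
        moreover have "h k < v k \<bullet> x" "v k \<bullet> x \<le> h k + t"
          using x v by (auto simp: R_def xw c_def field_simps)
        ultimately show "x \<in> Q t" by (simp add: Q_def cell_def)
      qed
      have "(b \<bullet> u - \<sigma>) - (a \<bullet> u + \<sigma>) = diameter e - \<eta>" by (simp add: ab(3) \<sigma>_def)
      then have "t * ((diameter e - \<eta>) / norm (v k)) = measure lebesgue (R t)"
        unfolding R_def rectangle_measure(4)[OF uw mn] by simp
      also have "\<dots> \<le> measure lebesgue (Q t)"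
        using \<open>R t \<subseteq> Q t\<close> Qm elim rectangle_measure(3)[OF uw mn]
        by (intro measure_mono_fmeasurable) (auto simp: R_def)
      finally show ?case using Qm elim by (simp add: e_def)
    qed
  qed
qed

text \<open>A lower bound needs only some disjoint pieces of the growth, so a finite
  \<open>N\<close> suffices. The corners of the grown cell, where several old constraints fail at
  once, are left out.\<close>

lemma measure_cell_grow:
  fixes v :: "'k \<Rightarrow> real^2"
  assumes lf: "locally_finite_constraints I v h"
    and v: "\<And>k. k \<in> I \<Longrightarrow> v k \<noteq> 0"
    and bdd: "\<And>t. bounded (cell I v h t)"
    and N: "finite N" "N \<subseteq> I"
    and generic: "\<And>k j x y. k \<in> N \<Longrightarrow> j \<in> I \<Longrightarrow> j \<noteq> k \<Longrightarrow> x \<in> edge I v h k \<inter> edge I v h j \<Longrightarrow>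
                    y \<in> edge I v h k \<inter> edge I v h j \<Longrightarrow> x = y"
    and \<eta>: "\<eta> > 0"
  shows "\<forall>\<^sub>F t in at_right 0. measure lebesgue (cell I v h 0)
           + t * ((\<Sum>k\<in>N. diameter (edge I v h k) / norm (v k)) - \<eta>) \<le> measure lebesgue (cell I v h t)"
proof -
  define C where "C = cell I v h"
  define Q where "Q k t = cell (I - {k}) v h 0 \<inter> {x. h k < v k \<bullet> x \<and> v k \<bullet> x \<le> h k + t}" for k t
  define s where "s = (\<Sum>k\<in>N. 1 / norm (v k))"
  have s: "s \<ge> 0" by (simp add: s_def sum_nonneg)
  define \<eta>' where "\<eta>' = \<eta> / (1 + s)"
  have \<eta>': "\<eta>' > 0" "\<eta>' * s \<le> \<eta>"
    using \<eta> s by (auto simp: \<eta>'_def field_simps)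
  have "\<forall>\<^sub>F t in at_right 0. Q k t \<in> lmeasurable \<and>
           t * ((diameter (edge I v h k) - \<eta>') / norm (v k)) \<le> measure lebesgue (Q k t)" if "k \<in> N" for k
    unfolding Q_def using measure_outer_strip_ge[OF lf _ bdd _ _ \<eta>'(1), of k] v N that generic by blast
  then have "\<forall>\<^sub>F t in at_right 0. \<forall>k\<in>N. Q k t \<in> lmeasurable \<and>
           t * ((diameter (edge I v h k) - \<eta>') / norm (v k)) \<le> measure lebesgue (Q k t)"
    using N(1) by (simp add: eventually_ball_finite)
  moreover have "\<forall>\<^sub>F t in at_right 0. 0 < (t::real)"
    by (simp add: eventually_at_right_less)
  ultimately show ?thesis
  proof eventually_elim
    case (elim t)
    have mC: "C s \<in> lmeasurable" for s by (simp add: C_def bdd compact_cell lmeasurable_compact)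
    have sub: "C 0 \<union> (\<Union>k\<in>N. Q k t) \<subseteq> C t"
    proof
      fix x assume "x \<in> C 0 \<union> (\<Union>k\<in>N. Q k t)"
      then consider "x \<in> C 0" | k where "k \<in> N" "x \<in> Q k t" by blast
      then show "x \<in> C t"
      proof cases
        case 1
        then show ?thesis using elim by (force simp: C_def cell_def)
      next
        case 2
        show ?thesis unfolding C_def cell_def
        proof safe
          fix j assume "j \<in> I"
          then show "v j \<bullet> x \<le> h j + t"
            using 2 elim by (cases "j = k") (force simp: Q_def cell_def)+
        qed
      qed
    qed
    have disj: "disjoint_family_on (\<lambda>k. Q k t) N"
      unfolding disjoint_family_on_def
    proof (intro ballI impI)
      fix m n assume "m \<in> N" "n \<in> N" "m \<noteq> n"
      then show "Q m t \<inter> Q n t = {}" using N(2) by (force simp: Q_def cell_def)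
    qed
    have disj0: "C 0 \<inter> (\<Union>k\<in>N. Q k t) = {}"
      using N(2) by (force simp: Q_def cell_def C_def)
    have "measure lebesgue (C 0) + t * ((\<Sum>k\<in>N. diameter (edge I v h k) / norm (v k)) - \<eta>)
        \<le> measure lebesgue (C 0) + t * ((\<Sum>k\<in>N. diameter (edge I v h k) / norm (v k)) - \<eta>' * s)"
      using elim \<eta>' by simp
    also have "t * ((\<Sum>k\<in>N. diameter (edge I v h k) / norm (v k)) - \<eta>' * s)
        = (\<Sum>k\<in>N. t * ((diameter (edge I v h k) - \<eta>') / norm (v k)))"
      by (simp add: s_def sum_distrib_left right_diff_distrib sum_subtractf diff_divide_distrib)
    also have "\<dots> \<le> (\<Sum>k\<in>N. measure lebesgue (Q k t))"
      using elim by (intro sum_mono) auto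
    also have "\<dots> = measure lebesgue (\<Union>k\<in>N. Q k t)"
      using measure_UNION'[of N "\<lambda>k. Q k t" lebesgue] N elim disj
      by (auto simp: disjoint_family_on_def pairwise_def disjnt_def)
    also have "measure lebesgue (C 0) + measure lebesgue (\<Union>k\<in>N. Q k t) = measure lebesgue (C 0 \<union> (\<Union>k\<in>N. Q k t))"
      using mC elim N disj0 by (subst measure_Un2) (auto simp: Diff_triv Int_commute fmeasurable.finite_UN)
    also have "\<dots> \<le> measure lebesgue (C t)"
      using sub mC elim N by (intro measure_mono_fmeasurable) (auto intro!: sets.Un sets.finite_UN)
    finally show ?case by (simp add: C_def)
  qed
qed

section \<open>Market regions\<close>

definition direction :: "('k \<Rightarrow> real^2) \<Rightarrow> 'k \<Rightarrow> 'k \<Rightarrow> real^2" where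
  "direction loc i k = loc k - loc i"

definition level :: "('k \<Rightarrow> real^2) \<Rightarrow> ('k \<Rightarrow> real) \<Rightarrow> 'k \<Rightarrow> 'k \<Rightarrow> real" where
  "level loc P i k = (P k - P i + (norm (loc k))\<^sup>2 - (norm (loc i))\<^sup>2) / 2"

text \<open>The quadratic terms in \<open>x\<close> cancel, and so does \<open>\<beta>\<close>:
  companies tie along straight lines, and the market is a power diagram. The factor 2 is why a shift
  \<open>t\<close> of the levels corresponds to a price step \<open>2 * t\<close>.\<close>

lemma agg_price_diff:
  "agg_price loc \<beta> P k x - agg_price loc \<beta> P i x = 2 * (level loc P i k - direction loc i k \<bullet> x)"
  unfolding agg_price_def level_def direction_def power2_norm_eq_inner
  by (simp add: inner_diff_left inner_diff_right inner_commute field_simps)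

lemma direction_le_level_iff:
  "direction loc i k \<bullet> x \<le> level loc P i k + t \<longleftrightarrow> agg_price loc \<beta> P i x \<le> agg_price loc \<beta> P k x + 2 * t"
  using agg_price_diff[of loc \<beta> P k x i] by argo

lemma owners_eq_singleton_iff:
  assumes "i \<in> K"
  shows "owners K loc \<beta> P x = {i} \<longleftrightarrow> (\<forall>k\<in>K - {i}. agg_price loc \<beta> P i x < agg_price loc \<beta> P k x)"
proof
  assume o: "owners K loc \<beta> P x = {i}"
  then have i: "i \<in> owners K loc \<beta> P x" by simp
  show "\<forall>k\<in>K - {i}. agg_price loc \<beta> P i x < agg_price loc \<beta> P k x"
  proof (intro ballI, rule ccontr)
    fix k assume k: "k \<in> K - {i}" "\<not> agg_price loc \<beta> P i x < agg_price loc \<beta> P k x"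
    then have "k \<in> owners K loc \<beta> P x"
      using i by (force simp: owners_def is_arg_min_linorder)
    then show False using o k by auto
  qed
next
  assume *: "\<forall>k\<in>K - {i}. agg_price loc \<beta> P i x < agg_price loc \<beta> P k x"
  show "owners K loc \<beta> P x = {i}"
  proof (intro equalityI subsetI)
    fix k assume "k \<in> owners K loc \<beta> P x"
    then have "k \<in> K" "\<not> agg_price loc \<beta> P i x < agg_price loc \<beta> P k x"
      using assms by (auto simp: owners_def is_arg_min_linorder not_less)
    then show "k \<in> {i}" using * by auto
  next
    fix k assume "k \<in> {i}"
    then show "k \<in> owners K loc \<beta> P x"
      using * assms by (auto simp: owners_def is_arg_min_linorder intro: less_imp_le)
  qed
qed

lemma market_region_eq:
  assumes "i \<in> K"
  shows "market_region K loc \<beta> P i = {x. \<forall>k\<in>K - {i}. agg_price loc \<beta> P i x < agg_price loc \<beta> P k x}"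
  by (simp add: market_region_def owners_eq_singleton_iff[OF assms])

text \<open>The own price enters every level with the same coefficient -1/2, so a price change is
  one common shift of all constraints.\<close>

lemma market_region_price_change:
  assumes "i \<in> K"
  shows "market_region K loc \<beta> (P(i := p)) i =
    {x. \<forall>k\<in>K - {i}. direction loc i k \<bullet> x < level loc P i k + (P i - p) / 2}"
proof -
  have "agg_price loc \<beta> (P(i := p)) i x < agg_price loc \<beta> (P(i := p)) k x \<longleftrightarrow>
     direction loc i k \<bullet> x < level loc P i k + (P i - p) / 2" if "k \<noteq> i" for x k
  proof -
    have "agg_price loc \<beta> (P(i := p)) i x = agg_price loc \<beta> P i x - (P i - p)"
      "agg_price loc \<beta> (P(i := p)) k x = agg_price loc \<beta> P k x"
      using that by (auto simp: agg_price_def)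
    then show ?thesis using agg_price_diff[of loc \<beta> P k x i] by argo
  qed
  then show ?thesis unfolding market_region_eq[OF assms] by auto
qed

text \<open>The segment from a point of the closed cell to a point \<open>z\<close> of the region
  satisfies all constraints strictly, except possibly at its start. Such a \<open>z\<close> matters:
  an empty region may have a segment or a point as its closed cell.\<close>

lemma closure_market_region:
  assumes "i \<in> K" "market_region K loc \<beta> P i \<noteq> {}"
  shows "closure (market_region K loc \<beta> P i) = cell (K - {i}) (direction loc i) (level loc P i) 0"
    (is "closure ?S = ?C")
proof (rule equalityI)
  have S: "?S = {x. \<forall>k\<in>K - {i}. direction loc i k \<bullet> x < level loc P i k}"
    using market_region_price_change[OF assms(1), of loc \<beta> P "P i"] by simp
  have "?S \<subseteq> {x. \<forall>k\<in>K - {i}. direction loc i k \<bullet> x \<le> level loc P i k}"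
    unfolding S by (blast intro: less_imp_le)
  then have "?S \<subseteq> ?C" by (simp add: cell_def)
  then show "closure ?S \<subseteq> ?C" by (simp add: closed_cell closure_minimal)
  obtain z where z: "z \<in> ?S" using assms by blast
  show "?C \<subseteq> closure ?S"
  proof
    fix x assume x: "x \<in> ?C"
    have "(1 - s) *\<^sub>R x + s *\<^sub>R z \<in> ?S" if s: "0 < s" "s < 1" for s
      unfolding S
    proof (intro CollectI ballI)
      fix k assume k: "k \<in> K - {i}"
      have "(1 - s) * (direction loc i k \<bullet> x) \<le> (1 - s) * level loc P i k"
        using x k s by (intro mult_left_mono) (auto simp: cell_def)
      moreover have "s * (direction loc i k \<bullet> z) < s * level loc P i k"
        using z k s by (auto simp: S)
      ultimately show "direction loc i k \<bullet> ((1 - s) *\<^sub>R x + s *\<^sub>R z) < level loc P i k"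
        by (simp add: inner_add_right algebra_simps)
    qed
    then have "\<forall>\<^sub>F s in at_right 0. (1 - s) *\<^sub>R x + s *\<^sub>R z \<in> closure ?S"
      unfolding eventually_at_right_field using closure_subset[of ?S]
      by (intro exI[of _ 1]) (simp add: subset_iff)
    moreover have "((\<lambda>s. (1 - s) *\<^sub>R x + s *\<^sub>R z) \<longlongrightarrow> (1 - 0) *\<^sub>R x + 0 *\<^sub>R z) (at_right (0::real))"
      by (intro tendsto_intros)
    ultimately show "x \<in> closure ?S"
      using Lim_in_closed_set[OF closed_closure, of _ ?S "at_right (0::real)"] by simp
  qed
qed

section \<open>Boundedness, local finiteness and area of market cells\<close>

locale market =
  fixes K :: "'k set" and loc :: "'k \<Rightarrow> real^2" and r :: real
  assumes distinct_positions: "inj_on loc K"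
    and locally_finite: "\<And>A. bounded A \<Longrightarrow> finite {k \<in> K. loc k \<in> A}"
    and every_disc: "\<And>c. \<exists>k \<in> K. loc k \<in> cball c r"
begin

abbreviation market_cell :: "('k \<Rightarrow> real) \<Rightarrow> 'k \<Rightarrow> real \<Rightarrow> (real^2) set" where
  "market_cell P i \<equiv> cell (K - {i}) (direction loc i) (level loc P i)"

abbreviation market_edge :: "('k \<Rightarrow> real) \<Rightarrow> 'k \<Rightarrow> 'k \<Rightarrow> (real^2) set" where
  "market_edge P i \<equiv> edge (K - {i}) (direction loc i) (level loc P i)"

lemma radius_nonneg: "0 \<le> r"
  using every_disc[of 0] by (auto intro: order_trans[OF norm_ge_zero])

lemma direction_nonzero: "i \<in> K \<Longrightarrow> k \<in> K - {i} \<Longrightarrow> direction loc i k \<noteq> 0"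
  using distinct_positions by (auto simp: direction_def inj_on_def)

text \<open>Some company lies within \<open>r\<close> of \<open>x\<close>; unless it is
  \<open>i\<close> itself, its aggregate price limits that of \<open>i\<close>. With capped prices
  this bounds the distance from \<open>x\<close> to \<open>loc i\<close>.\<close>

lemma nearby_rival:
  assumes "x \<in> market_cell P i t"
  shows "norm (x - loc i) \<le> r \<or>
    (\<exists>k\<in>K. norm (x - loc k) \<le> r \<and> P i + (norm (x - loc i))\<^sup>2 \<le> P k + r\<^sup>2 + 2 * t)"
proof -
  obtain k where k: "k \<in> K" "norm (x - loc k) \<le> r" using every_disc[of x] by (auto simp: dist_norm)
  show ?thesis
  proof (cases "k = i")
    case False
    then have "agg_price loc 0 P i x \<le> agg_price loc 0 P k x + 2 * t"
      using assms k direction_le_level_iff[where x = x and P = P and \<beta> = 0]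
      by (fastforce simp: cell_def)
    moreover have "(norm (x - loc k))\<^sup>2 \<le> r\<^sup>2" using k by (intro power_mono) auto
    ultimately show ?thesis using k by (auto simp: agg_price_def)
  qed (use k in auto)
qed

lemma bounded_market_cell:
  assumes "\<And>k. k \<in> K \<Longrightarrow> P k \<le> U"
  shows "bounded (market_cell P i t)"
proof -
  have "x \<in> cball (loc i) (r + sqrt (\<bar>U\<bar> + \<bar>P i\<bar> + r\<^sup>2 + 2 * \<bar>t\<bar>))" if x: "x \<in> market_cell P i t" for x
    using nearby_rival[OF x]
  proof
    assume "norm (x - loc i) \<le> r"
    moreover have "0 \<le> sqrt (\<bar>U\<bar> + \<bar>P i\<bar> + r\<^sup>2 + 2 * \<bar>t\<bar>)" by simp
    ultimately have "norm (x - loc i) \<le> r + sqrt (\<bar>U\<bar> + \<bar>P i\<bar> + r\<^sup>2 + 2 * \<bar>t\<bar>)" by linarith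
    then show ?thesis by (simp add: dist_norm norm_minus_commute)
  next
    assume "\<exists>k\<in>K. norm (x - loc k) \<le> r \<and> P i + (norm (x - loc i))\<^sup>2 \<le> P k + r\<^sup>2 + 2 * t"
    then obtain k where "k \<in> K" "P i + (norm (x - loc i))\<^sup>2 \<le> P k + r\<^sup>2 + 2 * t" by blast
    then have "(norm (x - loc i))\<^sup>2 \<le> \<bar>U\<bar> + \<bar>P i\<bar> + r\<^sup>2 + 2 * \<bar>t\<bar>" using assms[of k] by linarith
    then have "norm (x - loc i) \<le> sqrt (\<bar>U\<bar> + \<bar>P i\<bar> + r\<^sup>2 + 2 * \<bar>t\<bar>)" by (rule real_le_rsqrt)
    then show ?thesis using radius_nonneg by (simp add: dist_norm norm_minus_commute)
  qed
  then show ?thesis by (meson bounded_cball bounded_subset subsetI)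
qed

text \<open>As prices are nonnegative, a company whose constraint is nearly tight at a point of
  \<open>A\<close> must be located within a bounded distance of that point.\<close>

lemma locally_finite_market:
  assumes P: "\<And>k. k \<in> K \<Longrightarrow> 0 \<le> P k"
  shows "locally_finite_constraints (K - {i}) (direction loc i) (level loc P i)"
  unfolding locally_finite_constraints_def
proof (intro allI impI)
  fix A :: "(real^2) set" and s assume "bounded A"
  then obtain R where R: "\<And>x. x \<in> A \<Longrightarrow> norm x \<le> R" by (auto simp: bounded_iff)
  define M where "M = \<bar>P i\<bar> + (R + norm (loc i))\<^sup>2 + 2 * \<bar>s\<bar>"
  have "{k \<in> K - {i}. \<exists>x\<in>A. level loc P i k - s < direction loc i k \<bullet> x} \<subseteq> {k \<in> K. loc k \<in> cball 0 (R + sqrt M)}"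
  proof clarify
    fix k x assume k: "k \<in> K" "x \<in> A" "level loc P i k - s < direction loc i k \<bullet> x"
    then have "\<not> agg_price loc 0 P i x \<le> agg_price loc 0 P k x + 2 * (- s)"
      using direction_le_level_iff[where loc = loc and x = x and P = P and i = i and k = k and t = "- s" and \<beta> = 0] by linarith
    then have "P k + (norm (x - loc k))\<^sup>2 < P i + (norm (x - loc i))\<^sup>2 + 2 * s"
      by (simp add: agg_price_def)
    moreover have "(norm (x - loc i))\<^sup>2 \<le> (R + norm (loc i))\<^sup>2"
      using R[OF k(2)] norm_triangle_ineq4[of x "loc i"] by (intro power_mono) auto
    ultimately have "(norm (x - loc k))\<^sup>2 \<le> M"
      using P[OF k(1)] unfolding M_def by linarith
    then have "norm (x - loc k) \<le> sqrt M" by (rule real_le_rsqrt)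
    moreover have "norm (loc k) \<le> norm x + norm (x - loc k)"
      by (metis norm_minus_commute norm_triangle_sub)
    ultimately show "loc k \<in> cball 0 (R + sqrt M)" using R[OF k(2)] by simp
  qed
  then show "finite {k \<in> K - {i}. \<exists>x\<in>A. level loc P i k - s < direction loc i k \<bullet> x}"
    using finite_subset locally_finite[OF bounded_cball] by blast
qed

text \<open>The open region and the closed cell differ only on the lines of constraints tight
  somewhere in the cell. These are finitely many lines, hence negligible.\<close>

lemma market_area_price_change:
  assumes i: "i \<in> K" and P: "\<And>k. k \<in> K \<Longrightarrow> 0 \<le> P k \<and> P k \<le> U"
  shows "market_area K loc \<beta> (P(i := p)) i = measure lebesgue (market_cell P i ((P i - p) / 2))"
proof -
  define t where "t = (P i - p) / 2"
  define C where "C = market_cell P i t"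
  define S where "S = market_region K loc \<beta> (P(i := p)) i"
  have S: "S = {x. \<forall>k\<in>K - {i}. direction loc i k \<bullet> x < level loc P i k + t}"
    unfolding S_def t_def by (rule market_region_price_change[OF i])
  \<comment> \<open>The slack \<open>\<bar>t\<bar> + 1\<close> catches every constraint tight at
    shift \<open>t\<close>, whatever the sign of \<open>t\<close>.\<close>
  define J where "J = {k \<in> K - {i}. \<exists>x\<in>C. level loc P i k - (\<bar>t\<bar> + 1) < direction loc i k \<bullet> x}"
  have bdd: "bounded C" unfolding C_def using bounded_market_cell P by blast
  have "finite J"
    using locally_finite_market[of P i] P bdd unfolding locally_finite_constraints_def J_def by blast
  have neg: "negligible (\<Union>k\<in>J. {x. direction loc i k \<bullet> x = level loc P i k + t})"
    using \<open>finite J\<close> direction_nonzero[OF i]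
    by (auto simp: J_def intro!: negligible_Union negligible_hyperplane)
  have "C - S \<subseteq> (\<Union>k\<in>J. {x. direction loc i k \<bullet> x = level loc P i k + t})"
  proof
    fix x assume x: "x \<in> C - S"
    then obtain k where k: "k \<in> K - {i}" "\<not> direction loc i k \<bullet> x < level loc P i k + t"
      by (auto simp: S)
    moreover have "direction loc i k \<bullet> x \<le> level loc P i k + t"
      using x k by (auto simp: C_def cell_def)
    ultimately have "direction loc i k \<bullet> x = level loc P i k + t" by linarith
    moreover from this have "level loc P i k - (\<bar>t\<bar> + 1) < direction loc i k \<bullet> x" by linarith
    then have "k \<in> J" using x k(1) unfolding J_def by blast
    ultimately show "x \<in> (\<Union>k\<in>J. {x. direction loc i k \<bullet> x = level loc P i k + t})" by blast
  qed
  moreover have "S \<subseteq> C" unfolding S C_def cell_def using less_imp_le by blast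
  ultimately have "(C - S) \<union> (S - C) \<subseteq> (\<Union>k\<in>J. {x. direction loc i k \<bullet> x = level loc P i k + t})"
    by blast
  then have "negligible ((C - S) \<union> (S - C))" by (rule negligible_subset[OF neg])
  moreover have "C \<in> lmeasurable"
    using bdd unfolding C_def by (simp add: compact_cell lmeasurable_compact)
  ultimately have "measure lebesgue S = measure lebesgue C"
    by (intro measure_negligible_symdiff)
  then show ?thesis by (simp add: market_area_def S_def C_def t_def)
qed

lemma market_area_eq:
  assumes "i \<in> K" "\<And>k. k \<in> K \<Longrightarrow> 0 \<le> P k \<and> P k \<le> U"
  shows "market_area K loc \<beta> P i = measure lebesgue (market_cell P i 0)"
  using market_area_price_change[where P = P and i = i and p = "P i" and U = U] assms by simp

section \<open>Neighbors, border lines and ties\<close>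

lemma surviving_region_nonempty:
  "j \<in> surviving K loc \<beta> P \<Longrightarrow> market_region K loc \<beta> P j \<noteq> {}"
  by (auto simp: surviving_def market_area_def)

lemma mem_market_cell_iff:
  "i \<in> K \<Longrightarrow> x \<in> market_cell P i 0 \<longleftrightarrow> (\<forall>k\<in>K. agg_price loc \<beta> P i x \<le> agg_price loc \<beta> P k x)"
  using direction_le_level_iff[where x = x and P = P and i = i and t = 0 and \<beta> = \<beta>] by (force simp: cell_def)

lemma mem_market_edge_iff:
  "i \<in> K \<Longrightarrow> x \<in> market_edge P i j \<longleftrightarrow>
     (\<forall>k\<in>K. agg_price loc \<beta> P i x \<le> agg_price loc \<beta> P k x) \<and> agg_price loc \<beta> P j x = agg_price loc \<beta> P i x"
  using mem_market_cell_iff[where i = i and x = x and P = P and \<beta> = \<beta>] agg_price_diff[of loc \<beta> P j x i] by (auto simp: edge_def)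

text \<open>Surviving owners minimise over surviving companies, edges compare with all of
  \<open>K\<close>. Both agree on the closed cell of \<open>i\<close>, since \<open>i\<close>
  survives and is cheapest there among all companies.\<close>

lemma neighbors_eq:
  assumes "i \<in> surviving K loc \<beta> P"
  shows "neighbors K loc \<beta> P i = {j \<in> surviving K loc \<beta> P - {i}. market_edge P i j \<noteq> {}}"
proof -
  have i: "i \<in> K" using assms by (simp add: surviving_def)
  have cl: "closure (market_region K loc \<beta> P i) = market_cell P i 0"
    using closure_market_region[OF i surviving_region_nonempty] assms by blast
  show ?thesis
  proof (intro equalityI subsetI)
    fix j assume "j \<in> neighbors K loc \<beta> P i"
    then obtain x where j: "j \<noteq> i" "x \<in> market_cell P i 0"
      "is_arg_min (\<lambda>k. agg_price loc \<beta> P k x) (\<lambda>k. k \<in> surviving K loc \<beta> P) j"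
      by (auto simp: neighbors_def boundary_def cl surviving_owners_def)
    then have s: "j \<in> surviving K loc \<beta> P" and "agg_price loc \<beta> P j x \<le> agg_price loc \<beta> P i x"
      using assms by (auto simp: is_arg_min_linorder)
    moreover have "\<forall>k\<in>K. agg_price loc \<beta> P i x \<le> agg_price loc \<beta> P k x"
      using j mem_market_cell_iff[OF i] by blast
    moreover have "j \<in> K" using s by (simp add: surviving_def)
    ultimately have "x \<in> market_edge P i j"
      by (meson antisym mem_market_edge_iff[OF i])
    then show "j \<in> {j \<in> surviving K loc \<beta> P - {i}. market_edge P i j \<noteq> {}}" using j s by blast
  next
    fix j assume "j \<in> {j \<in> surviving K loc \<beta> P - {i}. market_edge P i j \<noteq> {}}"
    then obtain x where j: "j \<in> surviving K loc \<beta> P" "j \<noteq> i" "x \<in> market_edge P i j" by blast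
    then have x: "\<forall>k\<in>K. agg_price loc \<beta> P i x \<le> agg_price loc \<beta> P k x" "agg_price loc \<beta> P j x = agg_price loc \<beta> P i x"
      using mem_market_edge_iff[OF i] by blast+
    have "x \<in> closure (market_region K loc \<beta> P i)" unfolding cl using j by (simp add: edge_def)
    moreover have "x \<notin> market_region K loc \<beta> P i"
    proof -
      have "j \<in> K - {i}" "\<not> agg_price loc \<beta> P i x < agg_price loc \<beta> P j x"
        using x j by (auto simp: surviving_def)
      then show ?thesis unfolding market_region_eq[OF i] by blast
    qed
    ultimately have "x \<in> boundary K loc \<beta> P i" using interior_subset by (auto simp: boundary_def)
    moreover have "j \<in> surviving_owners K loc \<beta> P x"
      using x j by (auto simp: surviving_owners_def is_arg_min_linorder surviving_def)
    ultimately show "j \<in> neighbors K loc \<beta> P i" using j by (auto simp: neighbors_def)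
  qed
qed

lemma border_line_eq:
  assumes "i \<in> surviving K loc \<beta> P" "j \<in> surviving K loc \<beta> P"
  shows "border_line K loc \<beta> P i j = market_edge P i j"
proof -
  have K: "i \<in> K" "j \<in> K" using assms by (auto simp: surviving_def)
  have "closure (market_region K loc \<beta> P i) = market_cell P i 0"
    "closure (market_region K loc \<beta> P j) = market_cell P j 0"
    using K assms surviving_region_nonempty by (simp_all add: closure_market_region)
  then have border: "border_line K loc \<beta> P i j = market_cell P i 0 \<inter> market_cell P j 0"
    by (simp add: border_line_def)
  note cell_iff = mem_market_cell_iff[where P = P and \<beta> = \<beta>]
  note edge_iff = mem_market_edge_iff[where P = P and \<beta> = \<beta>, OF K(1)]
  show ?thesis
  proof (intro equalityI subsetI)
    fix x assume "x \<in> border_line K loc \<beta> P i j"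
    then have "\<forall>k\<in>K. agg_price loc \<beta> P i x \<le> agg_price loc \<beta> P k x"
      "\<forall>k\<in>K. agg_price loc \<beta> P j x \<le> agg_price loc \<beta> P k x"
      unfolding border using cell_iff K by blast+
    moreover from this have "agg_price loc \<beta> P j x = agg_price loc \<beta> P i x"
      using K by (intro antisym) blast+
    ultimately show "x \<in> market_edge P i j" using edge_iff by blast
  next
    fix x assume "x \<in> market_edge P i j"
    then have "\<forall>k\<in>K. agg_price loc \<beta> P i x \<le> agg_price loc \<beta> P k x"
      "agg_price loc \<beta> P j x = agg_price loc \<beta> P i x"
      using edge_iff by blast+
    then show "x \<in> border_line K loc \<beta> P i j"
      unfolding border Int_iff cell_iff[OF K(1)] cell_iff[OF K(2)] by simp
  qed
qed

lemma border_length_eq: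
  assumes "i \<in> surviving K loc \<beta> P" "j \<in> neighbors K loc \<beta> P i"
    and "\<And>k. k \<in> K \<Longrightarrow> P k \<le> U"
  shows "border_length K loc \<beta> P i j = diameter (market_edge P i j)"
proof -
  have j: "j \<in> surviving K loc \<beta> P" "j \<noteq> i" "market_edge P i j \<noteq> {}"
    using assms(2) by (auto simp: neighbors_eq[OF assms(1)])
  have "segment_length (market_edge P i j) = diameter (market_edge P i j)"
  proof (rule segment_length_eq_diameter)
    show "compact (market_edge P i j)"
      using bounded_market_cell assms(3) by (intro compact_edge) blast
    show "direction loc i j \<noteq> 0"
      using assms(1) j by (intro direction_nonzero) (auto simp: surviving_def)
    show "direction loc i j \<bullet> x = level loc P i j" if "x \<in> market_edge P i j" for x
      using that by (simp add: edge_def)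
  qed (rule convex_edge j(3))+
  then show ?thesis by (simp add: border_length_def border_line_eq[OF assms(1) j(1)])
qed

text \<open>Edges are convex, so two points of an edge span a segment in it. Used in contrapositive
  form: without a hidden rival, an edge with a company of area zero has at most one point.\<close>

lemma hidden_rivalI:
  assumes "i \<in> surviving K loc \<beta> P" "k \<in> K - surviving K loc \<beta> P"
    and ab: "a \<in> market_edge P i k" "b \<in> market_edge P i k" "a \<noteq> b"
  shows "hidden_rival K loc \<beta> P i"
proof -
  have i: "i \<in> K" using assms by (simp add: surviving_def)
  have cl: "closure (market_region K loc \<beta> P i) = market_cell P i 0"
    using closure_market_region[OF i surviving_region_nonempty] assms by blast
  have "x \<in> boundary K loc \<beta> P i \<inter> {x. k \<in> owners K loc \<beta> P x}" if "x \<in> closed_segment a b" for x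
  proof -
    have e: "x \<in> market_edge P i k"
      using that closed_segment_subset[OF ab(1,2) convex_edge] by blast
    then have x: "\<forall>k\<in>K. agg_price loc \<beta> P i x \<le> agg_price loc \<beta> P k x" "agg_price loc \<beta> P k x = agg_price loc \<beta> P i x"
      using mem_market_edge_iff[OF i] by blast+
    have "x \<in> closure (market_region K loc \<beta> P i)" unfolding cl using e by (simp add: edge_def)
    moreover have "x \<notin> market_region K loc \<beta> P i"
    proof -
      have "k \<in> K - {i}" "\<not> agg_price loc \<beta> P i x < agg_price loc \<beta> P k x"
        using x assms by auto
      then show ?thesis unfolding market_region_eq[OF i] by blast
    qed
    ultimately show ?thesis using interior_subset x assms(2)
      by (auto simp: boundary_def owners_def is_arg_min_linorder)
  qed
  then have "closed_segment a b \<subseteq> boundary K loc \<beta> P i \<inter> {x. k \<in> owners K loc \<beta> P x}" by (rule subsetI)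
  then show ?thesis unfolding hidden_rival_def using assms(2) ab(3) by blast
qed

text \<open>Of three companies that tie along a segment, the middle one has an empty market region.\<close>

lemma no_three_surviving_tie:
  assumes s: "i \<in> surviving K loc \<beta> P" "j \<in> surviving K loc \<beta> P" "k \<in> surviving K loc \<beta> P"
    and distinct: "i \<noteq> j" "i \<noteq> k" "j \<noteq> k"
    and x: "x \<in> market_edge P i j \<inter> market_edge P i k" and y: "y \<in> market_edge P i j \<inter> market_edge P i k"
  shows "x = y"
proof (rule ccontr)
  assume "x \<noteq> y"
  have K: "i \<in> K" "j \<in> K" "k \<in> K" using s by (auto simp: surviving_def)
  \<comment> \<open>Half the price advantage of \<open>m\<close> over \<open>i\<close> at
    \<open>z\<close>. On a common tie segment both directions are orthogonal to
    \<open>x - y\<close>, so \<open>f k\<close> is a multiple \<open>l\<close> of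
    \<open>f j\<close>.\<close>
  define f where "f m z = direction loc i m \<bullet> z - level loc P i m" for m z
  have agg: "agg_price loc \<beta> P m z = agg_price loc \<beta> P i z - 2 * f m z" for m z
    using agg_price_diff[of loc \<beta> P m z i] by (simp add: f_def)
  have e: "direction loc i j \<bullet> x = level loc P i j" "direction loc i k \<bullet> x = level loc P i k"
    "direction loc i j \<bullet> y = level loc P i j" "direction loc i k \<bullet> y = level loc P i k"
    using x y by (auto simp: edge_def)
  have "direction loc i j \<noteq> 0" using direction_nonzero K distinct by blast
  then obtain l where l: "direction loc i k = l *\<^sub>R direction loc i j"
    using orthogonal_parallel_2[of "x - y" "direction loc i j" "direction loc i k"] e \<open>x \<noteq> y\<close>
    by (auto simp: inner_diff_right)
  have fk: "f k z = l * f j z" for z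
    using e l by (simp add: f_def algebra_simps)
  obtain zi zj zk where z: "zi \<in> market_region K loc \<beta> P i" "zj \<in> market_region K loc \<beta> P j" "zk \<in> market_region K loc \<beta> P k"
    using s[THEN surviving_region_nonempty] by (auto simp: ex_in_conv[symmetric])
  have lt: "agg_price loc \<beta> P i zi < agg_price loc \<beta> P j zi"
    "agg_price loc \<beta> P j zj < agg_price loc \<beta> P i zj" "agg_price loc \<beta> P j zj < agg_price loc \<beta> P k zj"
    "agg_price loc \<beta> P k zk < agg_price loc \<beta> P i zk" "agg_price loc \<beta> P k zk < agg_price loc \<beta> P j zk"
    "agg_price loc \<beta> P i zi < agg_price loc \<beta> P k zi"
    using z K distinct by (auto simp: market_region_eq)
  \<comment> \<open>The point \<open>zi\<close> forces \<open>l > 0\<close> and \<open>zj\<close>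
    forces \<open>l < 1\<close>. Then \<open>j\<close> beats \<open>k\<close> wherever
    \<open>k\<close> beats \<open>i\<close>, contradicting the choice of \<open>zk\<close>.\<close>
  have "f j zi < 0" "f k zi < 0"
    using lt agg[of j zi] agg[of k zi] by linarith+
  then have "l > 0" unfolding fk by (simp add: mult_less_0_iff)
  have "f j zj > 0" "f k zj < f j zj"
    using lt agg[of j zj] agg[of k zj] by linarith+
  then have "l < 1" by (simp add: fk)
  have "f k zk > 0"
    using lt agg[of k zk] by linarith
  then have "f j zk > 0" using \<open>l > 0\<close> by (simp add: fk zero_less_mult_iff)
  moreover have "f j zk < f k zk"
    using lt agg[of j zk] agg[of k zk] by linarith
  ultimately show False using \<open>l < 1\<close> by (simp add: fk)
qed

section \<open>The equilibrium price\<close>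

text \<open>The lower bound \<open>(p - q * t) * (S + t * c)\<close> has slope
  \<open>p * c - q * S\<close> at 0, which optimality keeps from being positive. No
  differentiability of \<open>m\<close> is assumed, and \<open>q\<close> may have either sign, for
  price cuts and rises.\<close>

lemma first_order_condition:
  fixes m :: "real \<Rightarrow> real"
  assumes p: "p > 0"
    and opt: "\<forall>\<^sub>F t in at_right 0. (p - q * t) * m t \<le> p * S"
    and m: "\<And>\<eta>. \<eta> > 0 \<Longrightarrow> \<forall>\<^sub>F t in at_right 0. S + t * (c - \<eta>) \<le> m t"
  shows "p * c \<le> q * S"
proof (rule ccontr)
  assume "\<not> p * c \<le> q * S"
  \<comment> \<open>This choice keeps half of the excess slope \<open>p * c - q * S\<close>.\<close>
  define \<eta> where "\<eta> = (p * c - q * S) / (2 * p)"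
  have \<eta>: "\<eta> > 0" "p * (c - \<eta>) - q * S > 0"
    using p \<open>\<not> p * c \<le> q * S\<close> by (auto simp: \<eta>_def field_simps)
  have "((\<lambda>t. q * t * (c - \<eta>)) \<longlongrightarrow> q * 0 * (c - \<eta>)) (at_right 0)"
    by (intro tendsto_intros)
  then have "\<forall>\<^sub>F t in at_right 0. q * t * (c - \<eta>) < p * (c - \<eta>) - q * S"
    using \<eta>(2) order_tendstoD(2) by fastforce
  moreover have "((\<lambda>t. p - q * t) \<longlongrightarrow> p - q * 0) (at_right 0)"
    by (intro tendsto_intros)
  then have "\<forall>\<^sub>F t in at_right 0. 0 < p - q * t"
    using p order_tendstoD(1) by fastforce
  moreover have "\<forall>\<^sub>F t in at_right 0. 0 < (t::real)"
    by (simp add: eventually_at_right_less)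
  ultimately have "\<forall>\<^sub>F t in at_right (0::real). False"
    using opt m[OF \<eta>(1)]
  proof eventually_elim
    case (elim t)
    have "(p - q * t) * (S + t * (c - \<eta>)) \<le> p * S"
      using mult_left_mono[of "S + t * (c - \<eta>)" "m t" "p - q * t"] elim by linarith
    then have "t * (p * (c - \<eta>) - q * S - q * t * (c - \<eta>)) \<le> 0"
      by (simp add: algebra_simps)
    moreover have "t * (p * (c - \<eta>) - q * S - q * t * (c - \<eta>)) > 0"
      using elim by simp
    ultimately show False by linarith
  qed
  then show False by simp
qed

text \<open>Rivals cost at least their squared distance and stay a fixed distance
  \<open>\<delta>\<close> from \<open>loc i\<close>, so at a small price \<open>i\<close> owns a
  disc around its own position.\<close>

lemma exists_positive_payoff:
  assumes i: "i \<in> K" and P: "\<And>k. k \<in> K \<Longrightarrow> 0 \<le> P k \<and> P k \<le> U" and U: "U > 0"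
  obtains p where "p \<in> {0..U}" "payoff K loc \<beta> (P(i := p)) i > 0"
proof -
  define F where "F = {k \<in> K. loc k \<in> cball (loc i) 1} - {i}"
  have F: "finite F" unfolding F_def using locally_finite[OF bounded_cball] by blast
  \<comment> \<open>Inserting 1 covers an empty \<open>F\<close> and the companies outside the unit
    disc.\<close>
  define \<delta> where "\<delta> = Min (insert 1 ((\<lambda>k. dist (loc i) (loc k)) ` F))"
  have "dist (loc i) (loc k) > 0" if "k \<in> F" for k
    using that distinct_positions i by (auto simp: F_def inj_on_def)
  then have \<delta>: "\<delta> > 0" unfolding \<delta>_def using F by (subst Min_gr_iff) auto
  have far: "\<delta> \<le> dist (loc i) (loc k)" if "k \<in> K - {i}" for k
  proof (cases "k \<in> F")
    case True
    then show ?thesis unfolding \<delta>_def using F by (intro Min_le) auto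
  next
    case False
    then have "1 < dist (loc i) (loc k)" using that by (auto simp: F_def)
    moreover have "\<delta> \<le> 1" unfolding \<delta>_def using F by (intro Min_le) auto
    ultimately show ?thesis by simp
  qed
  \<comment> \<open>Within \<open>\<delta> / 4\<close> of \<open>loc i\<close>, company
    \<open>i\<close> costs at most \<open>\<delta>\<^sup>2 / 4 + \<delta>\<^sup>2 / 16\<close>,
    below the \<open>9 / 16 * \<delta>\<^sup>2\<close> that any rival costs at least (leaving
    \<open>\<beta>\<close> aside).\<close>
  define p where "p = min U (\<delta>\<^sup>2 / 4)"
  have p: "0 < p" "p \<le> U" "p \<le> \<delta>\<^sup>2 / 4" using U \<delta> by (auto simp: p_def)
  have sub: "ball (loc i) (\<delta> / 4) \<subseteq> market_cell P i ((P i - p) / 2)"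
  proof
    fix x assume "x \<in> ball (loc i) (\<delta> / 4)"
    then have x: "norm (x - loc i) < \<delta> / 4" by (simp add: dist_norm norm_minus_commute)
    have "direction loc i k \<bullet> x \<le> level loc P i k + (P i - p) / 2" if k: "k \<in> K - {i}" for k
    proof -
      have "norm (loc i - loc k) \<le> norm (x - loc i) + norm (x - loc k)"
        using norm_triangle_ineq4[of "x - loc k" "x - loc i"] by simp
      then have "3 * \<delta> / 4 \<le> norm (x - loc k)"
        using far[OF k] x by (simp add: dist_norm)
      then have "(3 * \<delta> / 4)\<^sup>2 \<le> (norm (x - loc k))\<^sup>2" using \<delta> by (intro power_mono) auto
      moreover have "(norm (x - loc i))\<^sup>2 \<le> (\<delta> / 4)\<^sup>2" using x by (intro power_mono) auto
      moreover have "(3 * \<delta> / 4)\<^sup>2 = 9 / 16 * \<delta>\<^sup>2" "(\<delta> / 4)\<^sup>2 = \<delta>\<^sup>2 / 16" "0 \<le> \<delta>\<^sup>2"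
        by (simp_all add: power2_eq_square)
      ultimately have "p + (norm (x - loc i))\<^sup>2 \<le> (norm (x - loc k))\<^sup>2"
        using p(3) by linarith
      then have "agg_price loc 0 P i x \<le> agg_price loc 0 P k x + 2 * ((P i - p) / 2)"
        using P[of k] k unfolding agg_price_def by (simp add: field_simps)
      then show ?thesis by (rule iffD2[OF direction_le_level_iff])
    qed
    then show "x \<in> market_cell P i ((P i - p) / 2)" by (simp add: cell_def)
  qed
  have "0 < measure lebesgue (ball (loc i) (\<delta> / 4))"
    using \<delta> content_ball_pos[of "\<delta> / 4" "loc i"] by simp
  also have "\<dots> \<le> measure lebesgue (market_cell P i ((P i - p) / 2))"
    using sub bounded_market_cell P
    by (intro measure_mono_fmeasurable lmeasurable_compact compact_cell) (auto, blast)
  also have "\<dots> = market_area K loc \<beta> (P(i := p)) i"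
    using market_area_price_change[where P = P, OF i P] by simp
  finally show thesis using that[of p] p by (simp add: payoff_def)
qed

text \<open>Doubling the cell about one of its points \<open>y0\<close> fits it into the cell at half the price:
  nearby rivals leave enough room because their direction vectors are short, distant ones
  because they are out of reach. So halving the price quadruples the area.\<close>

lemma half_price_improves:
  assumes i: "i \<in> K" and P: "\<And>k. k \<in> K \<Longrightarrow> 0 \<le> P k \<and> P k \<le> U"
    and top: "P i = U" and U: "U > 96 * r\<^sup>2" and pos: "market_area K loc \<beta> P i > 0"
  shows "payoff K loc \<beta> P i < payoff K loc \<beta> (P(i := U / 2)) i"
proof -
  have "U > 0" using U le_less_trans[of 0 "96 * r\<^sup>2" U] by simp
  define C where "C = market_cell P i"
  have mC: "C t \<in> lmeasurable" for t
    unfolding C_def using bounded_market_cell P by (intro lmeasurable_compact compact_cell) blast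
  have area: "market_area K loc \<beta> P i = measure lebesgue (C 0)"
    unfolding C_def by (rule market_area_eq[where P = P, OF i P])
  then have "C 0 \<noteq> {}" using pos by auto
  then obtain y0 where y0: "y0 \<in> C 0" by blast
  \<comment> \<open>At the top price no rival is dearer, so the cell of \<open>i\<close> lies in the
    disc of radius \<open>r\<close> about \<open>loc i\<close>.\<close>
  have near: "norm (y - loc i) \<le> r" if "y \<in> C 0" for y
  proof -
    have "norm (y - loc i) \<le> r \<or> (\<exists>k\<in>K. P i + (norm (y - loc i))\<^sup>2 \<le> P k + r\<^sup>2)"
      using nearby_rival[where x = y and P = P and i = i and t = 0] that by (auto simp: C_def)
    moreover have "norm (y - loc i) \<le> r" if "k \<in> K" "P i + (norm (y - loc i))\<^sup>2 \<le> P k + r\<^sup>2" for k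
    proof -
      have "(norm (y - loc i))\<^sup>2 \<le> r\<^sup>2" using that P[of k] top by linarith
      then show ?thesis using radius_nonneg power2_le_imp_le by blast
    qed
    ultimately show ?thesis by blast
  qed
  \<comment> \<open>The homothety with centre \<open>y0\<close> and ratio 2. The target shift
    \<open>U / 4\<close> is half of the price cut \<open>U - U / 2\<close>.\<close>
  define T where "T y = 2 *\<^sub>R y + (- y0)" for y
  have "T ` C 0 \<subseteq> C (U / 4)"
  proof clarify
    fix y assume y: "y \<in> C 0"
    have n: "norm (y - loc i) \<le> r" "norm (y0 - loc i) \<le> r" using near y y0 by auto
    have n2: "norm (y - y0) \<le> 2 * r" using norm_triangle_ineq4[of "y - loc i" "y0 - loc i"] n by simp
    have "direction loc i k \<bullet> T y \<le> level loc P i k + U / 4" if k: "k \<in> K - {i}" for k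
    proof (cases "8 * r * norm (direction loc i k) \<le> U")
      case True
      have "direction loc i k \<bullet> (y - y0) \<le> norm (direction loc i k) * norm (y - y0)"
        by (rule norm_cauchy_schwarz)
      also have "\<dots> \<le> norm (direction loc i k) * (2 * r)" using n2 by (intro mult_left_mono) auto
      also have "\<dots> \<le> U / 4" using True by (simp add: mult_ac)
      finally have "direction loc i k \<bullet> (y - y0) \<le> U / 4" .
      moreover have "direction loc i k \<bullet> y \<le> level loc P i k" using y k by (auto simp: C_def cell_def)
      moreover have "direction loc i k \<bullet> T y = direction loc i k \<bullet> y + direction loc i k \<bullet> (y - y0)"
        by (simp add: T_def inner_add_right inner_diff_right)
      ultimately show ?thesis by linarith
    next
      case False
      \<comment> \<open>The threshold \<open>96 * r\<^sup>2\<close> gives \<open>d > 12 * r\<close>.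
        As \<open>T y\<close> is within \<open>3 * r\<close> of \<open>loc i\<close>, it suffices
        that \<open>3 * r * d \<le> d\<^sup>2 / 2 - U / 4\<close>; indeed
        \<open>d\<^sup>2 / 2 \<ge> 6 * r * d\<close> and \<open>U / 4 < 2 * r * d\<close>.\<close>
      define d where "d = norm (direction loc i k)"
      have d: "U < 8 * r * d" "0 \<le> d" using False by (auto simp: d_def)
      have "r > 0" using d \<open>U > 0\<close> radius_nonneg by (cases "r = 0") auto
      have "8 * r * (12 * r) = 96 * r\<^sup>2" by (simp add: power2_eq_square)
      then have "8 * r * (12 * r) < 8 * r * d" using d(1) U by linarith
      then have d12: "12 * r < d" using \<open>r > 0\<close> mult_less_cancel_left_pos[of "8 * r"] by simp
      then have "12 * r * d \<le> d\<^sup>2" using d(2) unfolding power2_eq_square by (intro mult_right_mono) auto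
      moreover have T_eq: "T y - loc i = 2 *\<^sub>R (y - loc i) - (y0 - loc i)"
        by (simp add: T_def algebra_simps scaleR_2)
      have "norm (T y - loc i) \<le> norm (2 *\<^sub>R (y - loc i)) + norm (y0 - loc i)"
        unfolding T_eq by (rule norm_triangle_ineq4)
      then have "norm (T y - loc i) \<le> 3 * r" using n by simp
      then have "d * norm (T y - loc i) \<le> d * (3 * r)" using d(2) by (intro mult_left_mono)
      moreover have "direction loc i k \<bullet> (T y - loc i) \<le> d * norm (T y - loc i)"
        unfolding d_def by (rule norm_cauchy_schwarz)
      moreover have "level loc P i k = (P k - U) / 2 + d\<^sup>2 / 2 + direction loc i k \<bullet> loc i"
        unfolding level_def d_def direction_def power2_norm_eq_inner top
        by (simp add: inner_diff_left inner_diff_right inner_commute field_simps)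
      moreover have "P k \<ge> 0" using P k by blast
      moreover have "d * (3 * r) = 3 * (r * d)" "12 * r * d = 12 * (r * d)" "8 * r * d = 8 * (r * d)"
        by simp_all
      ultimately show ?thesis using d(1) \<open>U > 0\<close> unfolding inner_diff_right by argo
    qed
    then show "T y \<in> C (U / 4)" by (simp add: C_def cell_def)
  qed
  moreover have "T ` C 0 \<in> lmeasurable"
  proof -
    have "compact (C 0)" unfolding C_def using bounded_market_cell P by (intro compact_cell) blast
    then have "compact (T ` C 0)"
      unfolding T_def by (intro compact_continuous_image continuous_intros)
    then show ?thesis by (rule lmeasurable_compact)
  qed
  moreover have "measure lebesgue (T ` C 0) = 4 * measure lebesgue (C 0)"
    using measure_lebesgue_affine[of 2 "- y0" "C 0"] by (simp add: T_def[abs_def])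
  ultimately have "4 * measure lebesgue (C 0) \<le> measure lebesgue (C (U / 4))"
    using mC by (metis fmeasurableD measure_mono_fmeasurable)
  \<comment> \<open>Half the price at no less than four times the area at least doubles the positive
    payoff.\<close>
  then have "U / 2 * (4 * measure lebesgue (C 0)) \<le> U / 2 * measure lebesgue (C (U / 4))"
    using \<open>U > 0\<close> by (intro mult_left_mono) auto
  moreover have "market_area K loc \<beta> (P(i := U / 2)) i = measure lebesgue (C (U / 4))"
    using market_area_price_change[where P = P and i = i and p = "U / 2" and U = U] i P by (simp add: C_def top)
  moreover have "0 < U * measure lebesgue (C 0)" using pos area \<open>U > 0\<close> by simp
  ultimately show ?thesis by (simp add: payoff_def area top)
qed

text \<open>Both estimates bound the area after the change from below, with the same rate
  \<open>L\<close>. They are the grow and shrink bounds for the cell of \<open>i\<close>, with the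
  neighbors as \<open>N\<close>.\<close>

lemma market_area_first_order:
  assumes P: "\<And>k. k \<in> K \<Longrightarrow> 0 \<le> P k \<and> P k \<le> U"
    and i: "i \<in> surviving K loc \<beta> P" and nh: "\<not> hidden_rival K loc \<beta> P i" and \<eta>: "\<eta> > 0"
  defines "L \<equiv> \<Sum>j\<in>neighbors K loc \<beta> P i. border_length K loc \<beta> P i j / dist (loc i) (loc j)"
  shows "\<forall>\<^sub>F t in at_right 0. market_area K loc \<beta> P i + t * (L - \<eta>)
           \<le> market_area K loc \<beta> (P(i := P i - 2 * t)) i"
    and "\<forall>\<^sub>F t in at_right 0. market_area K loc \<beta> P i + t * (- L - \<eta>)
           \<le> market_area K loc \<beta> (P(i := P i + 2 * t)) i"
proof -
  have iK: "i \<in> K" using i by (simp add: surviving_def)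
  define N where "N = neighbors K loc \<beta> P i"
  have N_eq: "N = {j \<in> surviving K loc \<beta> P - {i}. market_edge P i j \<noteq> {}}"
    unfolding N_def by (rule neighbors_eq[OF i])
  have lf: "locally_finite_constraints (K - {i}) (direction loc i) (level loc P i)"
    using locally_finite_market P by blast
  have bdd: "bounded (market_cell P i t)" for t using bounded_market_cell P by blast
  have "N \<subseteq> {k \<in> K - {i}. \<exists>x\<in>market_cell P i 0. level loc P i k - 1 < direction loc i k \<bullet> x}"
    by (force simp: N_eq surviving_def edge_def)
  then have N: "finite N" "N \<subseteq> K - {i}"
    using lf bdd finite_subset unfolding locally_finite_constraints_def by blast+
  have hidden_free: "x = y" if "k \<in> K - surviving K loc \<beta> P" "x \<in> market_edge P i k" "y \<in> market_edge P i k" for k x y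
    using hidden_rivalI[OF i that] nh by blast
  have rest: "diameter (market_edge P i k) = 0" if "k \<in> K - {i} - N" for k
  proof (cases "market_edge P i k = {}")
    case False
    then have "k \<in> K - surviving K loc \<beta> P" using that by (auto simp: N_eq)
    then have "\<exists>x. market_edge P i k = {x}" using False hidden_free by blast
    then show ?thesis by auto
  qed simp
  \<comment> \<open>Two edges sharing two points would be a tie of three surviving companies, or an
    edge of positive length with a company of area zero.\<close>
  have generic: "x = y" if "k \<in> N" "j \<in> K - {i}" "j \<noteq> k"
      "x \<in> market_edge P i k \<inter> market_edge P i j" "y \<in> market_edge P i k \<inter> market_edge P i j" for k j x y
  proof (cases "j \<in> surviving K loc \<beta> P")
    case True
    then show ?thesis using no_three_surviving_tie[OF i, of k j x y] that by (auto simp: N_eq)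
  next
    case False
    then show ?thesis using hidden_free[of j x y] that by blast
  qed
  have L: "(\<Sum>k\<in>N. diameter (market_edge P i k) / norm (direction loc i k)) = L"
    unfolding L_def N_def
  proof (rule sum.cong[OF refl])
    fix k assume "k \<in> neighbors K loc \<beta> P i"
    then have "border_length K loc \<beta> P i k = diameter (market_edge P i k)"
      using border_length_eq[OF i] P by blast
    then show "diameter (market_edge P i k) / norm (direction loc i k) = border_length K loc \<beta> P i k / dist (loc i) (loc k)"
      by (simp add: direction_def dist_norm norm_minus_commute)
  qed
  have area: "market_area K loc \<beta> (P(i := p)) i = measure lebesgue (market_cell P i ((P i - p) / 2))" for p
    by (rule market_area_price_change[where P = P, OF iK P])
  have area0: "market_area K loc \<beta> P i = measure lebesgue (market_cell P i 0)"
    by (rule market_area_eq[where P = P, OF iK P])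
  show "\<forall>\<^sub>F t in at_right 0. market_area K loc \<beta> P i + t * (L - \<eta>)
           \<le> market_area K loc \<beta> (P(i := P i - 2 * t)) i"
    using measure_cell_grow[OF lf direction_nonzero[OF iK] bdd N generic \<eta>]
    by (simp add: area area0 L)
  show "\<forall>\<^sub>F t in at_right 0. market_area K loc \<beta> P i + t * (- L - \<eta>)
           \<le> market_area K loc \<beta> (P(i := P i + 2 * t)) i"
    using measure_cell_shrink[OF lf direction_nonzero[OF iK] bdd N rest \<eta>]
    by (simp add: area area0 L algebra_simps)
qed

lemma equilibrium_price:
  assumes P: "\<And>k. k \<in> K \<Longrightarrow> 0 \<le> P k \<and> P k \<le> U" and i: "i \<in> K" and U: "U > 96 * r\<^sup>2"
    and best: "\<And>p. p \<in> {0..U} \<Longrightarrow> payoff K loc \<beta> (P(i := p)) i \<le> payoff K loc \<beta> P i"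
    and nh: "\<not> hidden_rival K loc \<beta> P i"
  shows "P i = 1 / (\<Sum>j\<in>neighbors K loc \<beta> P i. border_length K loc \<beta> P i j / (2 * dist (loc i) (loc j)))
           * market_area K loc \<beta> P i"
proof -
  have "U > 0" using U le_less_trans[of 0 "96 * r\<^sup>2" U] by simp
  define A where "A = market_area K loc \<beta> P i"
  obtain p where "p \<in> {0..U}" "0 < payoff K loc \<beta> (P(i := p)) i"
    using exists_positive_payoff[where P = P and i = i and U = U and \<beta> = \<beta>] i P \<open>U > 0\<close> by blast
  then have "0 < payoff K loc \<beta> P i" using best[of p] by simp
  moreover have "A \<ge> 0" by (simp add: A_def market_area_def)
  ultimately have pos: "P i > 0" "A > 0"
    using P[OF i] by (auto simp: payoff_def A_def zero_less_mult_iff)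
  then have s: "i \<in> surviving K loc \<beta> P" using i by (simp add: surviving_def A_def)
  have "P i \<noteq> U"
    using half_price_improves[where P = P and i = i and \<beta> = \<beta>, OF i P _ U] best[of "U / 2"] \<open>U > 0\<close> pos(2) by (force simp: A_def)
  then have lt: "P i < U" using P[OF i] by simp
  define L where "L = (\<Sum>j\<in>neighbors K loc \<beta> P i. border_length K loc \<beta> P i j / dist (loc i) (loc j))"
  have small: "\<forall>\<^sub>F t in at_right 0. 0 < t \<and> 2 * t < P i \<and> P i + 2 * t < U"
    unfolding eventually_at_right_field using pos lt
    by (intro exI[of _ "min (P i / 2) ((U - P i) / 2)"]) (auto simp: field_simps)
  have "P i * L \<le> 2 * A"
  proof (rule first_order_condition)
    show "\<forall>\<^sub>F t in at_right 0. (P i - 2 * t) * market_area K loc \<beta> (P(i := P i - 2 * t)) i \<le> P i * A"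
      using small
    proof eventually_elim
      case (elim t)
      then show ?case using best[of "P i - 2 * t"] lt by (simp add: payoff_def A_def)
    qed
  qed (use pos market_area_first_order(1)[where P = P, OF P s nh] in \<open>auto simp: A_def L_def\<close>)
  \<comment> \<open>A price rise is the case \<open>q = -2\<close>, \<open>c = - L\<close>, which
    reverses the inequality obtained from the cut.\<close>
  moreover have "P i * (- L) \<le> (- 2) * A"
  proof (rule first_order_condition)
    show "\<forall>\<^sub>F t in at_right 0. (P i - (- 2) * t) * market_area K loc \<beta> (P(i := P i + 2 * t)) i \<le> P i * A"
      using small
    proof eventually_elim
      case (elim t)
      then show ?case using best[of "P i + 2 * t"] pos by (simp add: payoff_def A_def)
    qed
  qed (use pos market_area_first_order(2)[where P = P, OF P s nh] in \<open>auto simp: A_def L_def\<close>)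
  ultimately have eq: "P i * (L / 2) = A" by simp
  have sum: "(\<Sum>j\<in>neighbors K loc \<beta> P i. border_length K loc \<beta> P i j / (2 * dist (loc i) (loc j))) = L / 2"
    by (simp add: L_def sum_divide_distrib mult.commute)
  \<comment> \<open>The area is positive, so the quotient in the conclusion is a genuine one and not
    a division by zero.\<close>
  have "L \<noteq> 0" using eq pos by auto
  with eq have "P i = 1 / (L / 2) * A" by (simp add: field_simps)
  then show ?thesis unfolding sum A_def .
qed

end

theorem theorem6:
  fixes K :: "'k set" and loc :: "'k \<Rightarrow> real^2" and B \<beta> r :: real
  assumes distinct_positions: "inj_on loc K"
    and locally_finite: "\<And>A. bounded A \<Longrightarrow> finite {k \<in> K. loc k \<in> A}"
    and every_disc: "\<And>c. \<exists>k \<in> K. loc k \<in> cball c r"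
    and "B > 0"
    and "players K loc B \<noteq> {}"
    and "\<beta> \<ge> 0"
  shows "\<exists>threshold. \<forall>P_upper > threshold. \<forall>P0 P.
           (\<forall>j \<in> K - players K loc B. P0 j \<in> {0..P_upper}) \<longrightarrow>
           nash_equilibrium K loc \<beta> B P_upper P0 P \<longrightarrow>
           (\<forall>i \<in> players K loc B. \<not> hidden_rival K loc \<beta> P i \<longrightarrow>
              P i = 1 / (\<Sum>j \<in> neighbors K loc \<beta> P i.
                           border_length K loc \<beta> P i j / (2 * dist (loc i) (loc j)))
                    * market_area K loc \<beta> P i)"
proof (intro exI[of _ "96 * r\<^sup>2"] allI impI ballI)
  \<comment> \<open>The threshold stems from \<open>half_price_improves\<close> and depends only on
    \<open>r\<close>.\<close>
  interpret market K loc r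
    using distinct_positions locally_finite every_disc by unfold_locales
  fix U P0 P i
  assume U: "96 * r\<^sup>2 < U" and P0: "\<forall>j \<in> K - players K loc B. P0 j \<in> {0..U}"
    and nash: "nash_equilibrium K loc \<beta> B U P0 P"
    and i: "i \<in> players K loc B" and nh: "\<not> hidden_rival K loc \<beta> P i"
  have best: "is_arg_max (\<lambda>p. payoff K loc \<beta> (P(j := p)) j) (\<lambda>p. p \<in> {0..U}) (P j)"
    if "j \<in> players K loc B" for j
    using nash that by (simp add: nash_equilibrium_def)
  \<comment> \<open>The cell estimates need price bounds on all of \<open>K\<close>: feasibility of
    a best response gives them for players, the assumption on \<open>P0\<close> for the
    rest.\<close>
  have P: "0 \<le> P k \<and> P k \<le> U" if "k \<in> K" for k
  proof (cases "k \<in> players K loc B")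
    case True
    then show ?thesis using best[of k] by (simp add: is_arg_max_def)
  next
    case False
    then have "P k = P0 k" using nash that by (simp add: nash_equilibrium_def)
    then show ?thesis using P0 that False by simp
  qed
  show "P i = 1 / (\<Sum>j \<in> neighbors K loc \<beta> P i.
                     border_length K loc \<beta> P i j / (2 * dist (loc i) (loc j)))
                * market_area K loc \<beta> P i"
  proof (rule equilibrium_price[where P = P, OF P _ U _ nh])
    show "i \<in> K" using i by (simp add: players_def)
    fix p assume "p \<in> {0..U}"
    then show "payoff K loc \<beta> (P(i := p)) i \<le> payoff K loc \<beta> P i"
      using best[OF i] by (force simp: is_arg_max_def not_less)
  qed
qed

end
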